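(* Let $\mathbb{K}$ be an infinite field, $n\geq 3$, $R=\mathbb{K}[x_1,\ldots,x_n]$ and $\mathfrak{m}=\langle x_1,\ldots,x_n\rangle$. Let $f,g\in R$ be (nonzero) forms of respective degrees $2\leq d\leq e$, and set $F:=fg$. Then: (i) Assume that ${\rm char}(\mathbb{K})$ does not divide $d$ or $d+e$. If $f$ is smooth then $g^2\in J_F^{\rm sat}$. (ii) Assume that ${\rm char}(\mathbb{K})$ does not divide either $e$ or $d+e$. If $f$ and $g$ have no proper common factors, then $${\rm indeg}(\mathrm{Syz}(J_F))\geq {\rm indeg}(\mathrm{Syz}(J_g)).$$ In particular, if moreover $g$ is smooth then ${\rm indeg}(\mathrm{Syz}(J_F))\geq e-1\geq \left\lfloor \frac{d+e}{2}\right\rfloor -1$. (iii) Assume that ${\rm char}(\mathbb{K})$ does not divide any of $d,e,d+e$ and suppose that the following conditions are satisfied: (a) $f$ is smooth; (b) the Jacobian matrix of $\{f,g\}$ has maximal rank over $R/\wp$, for every prime ideal $\wp\supset \langle f,g\rangle$ of height $n-1$; (c) the ideal $\langle f,J_g\rangle$ is $\mathfrak{m}$-primary. Then $\mathrm{depth}(R/J_F)=0$.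
   Context: For a form $h\in R$, $h_{x_i}=\partial h/\partial x_i$, $J_h=\langle h_{x_1},\ldots,h_{x_n}\rangle$ is its Jacobian ideal, and $\mathrm{Syz}(J_h)=\{(P_1,\ldots,P_n)\in R^n:\sum_iP_ih_{x_i}=0\}$ is the syzygy module of its partial derivatives, graded so that $(P_1,\ldots,P_n)$ has degree $r$ if all $P_i$ are forms of degree $r$ (or zero); ${\rm indeg}$ denotes the least degree in which this graded module is nonzero. A form $h$ is called smooth if the hypersurface $\mathrm{Proj}(R/(h))$ is smooth; for ${\rm char}(\mathbb{K})\nmid\deg h$ this means that $J_h$ is $\mathfrak{m}$-primary (a complete intersection of codimension $n$). The Jacobian matrix of $\{f,g\}$ is the $2\times n$ matrix with rows $(f_{x_1},\ldots,f_{x_n})$ and $(g_{x_1},\ldots,g_{x_n})$; maximal rank means rank $2$. $I^{\rm sat}=I:\mathfrak{m}^\infty$. Depth is with respect to $\mathfrak{m}$. *)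

theory Defs
  imports
    "HOL-Computational_Algebra.Computational_Algebra"
    "HOL-Library.Poly_Mapping"
    "HOL-Library.Extended_Nat"
    "HOL-Library.Cardinality"
begin

section \<open>Ideals of a commutative ring\<close>

text \<open>An ideal is a submodule of the ring viewed as a module over itself; the library locale
  \<open>module\<close> is used with multiplication as its scalar action.\<close>

lemma module_times: "module ((*) :: 'a::comm_ring_1 \<Rightarrow> 'a \<Rightarrow> 'a)"
  by unfold_locales (simp_all add: algebra_simps)

definition is_ideal :: "'a::comm_ring_1 set \<Rightarrow> bool" where
  "is_ideal I \<longleftrightarrow> module.subspace (*) I"

definition ideal_gen :: "'a::comm_ring_1 set \<Rightarrow> 'a set" where
  "ideal_gen S = module.span (*) S"

definition prime_ideal :: "'a::comm_ring_1 set \<Rightarrow> bool" where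
  "prime_ideal P \<longleftrightarrow> is_ideal P \<and> 1 \<notin> P \<and> (\<forall>a b. a * b \<in> P \<longrightarrow> a \<in> P \<or> b \<in> P)"

definition radical :: "'a::comm_ring_1 set \<Rightarrow> 'a set" where
  "radical I = {a. \<exists>k. a ^ k \<in> I}"

definition primary_ideal :: "'a::comm_ring_1 set \<Rightarrow> bool" where
  "primary_ideal Q \<longleftrightarrow> is_ideal Q \<and> 1 \<notin> Q \<and> (\<forall>a b. a * b \<in> Q \<longrightarrow> a \<in> Q \<or> b \<in> radical Q)"

text \<open>\<open>Q\<close> is \<open>P\<close>-primary.\<close>

definition is_primary_to :: "'a::comm_ring_1 set \<Rightarrow> 'a set \<Rightarrow> bool" where
  "is_primary_to P Q \<longleftrightarrow> primary_ideal Q \<and> radical Q = P"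

definition ideal_power :: "'a::comm_ring_1 set \<Rightarrow> nat \<Rightarrow> 'a set" where
  "ideal_power I k = ideal_gen {prod_list as | as. length as = k \<and> set as \<subseteq> I}"

definition colon :: "'a::comm_ring_1 set \<Rightarrow> 'a set \<Rightarrow> 'a set" where
  "colon I A = {a. \<forall>b\<in>A. a * b \<in> I}"

text \<open>\<open>saturation A I\<close> is \<open>I : A\<^sup>\<infinity>\<close>.\<close>

definition saturation :: "'a::comm_ring_1 set \<Rightarrow> 'a set \<Rightarrow> 'a set" where
  "saturation A I = (\<Union>k. colon I (ideal_power A k))"

definition height :: "'a::comm_ring_1 set \<Rightarrow> enat" where
  "height P = Sup {enat k | k. \<exists>C. (\<forall>i\<le>k. prime_ideal (C i)) \<and> (\<forall>i<k. C i \<subset> C (Suc i)) \<and> C k = P}"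

text \<open>Regular sequences on the module \<open>R/I\<close>: each element is a nonzerodivisor on the quotient
  of \<open>R/I\<close> by its predecessors, and the quotient by the whole sequence is nonzero.\<close>

definition regular_sequence_on_quotient :: "'a::comm_ring_1 set \<Rightarrow> 'a list \<Rightarrow> bool" where
  "regular_sequence_on_quotient I as \<longleftrightarrow>
     (\<forall>i<length as. \<forall>x. as ! i * x \<in> ideal_gen (I \<union> set (take i as))
         \<longrightarrow> x \<in> ideal_gen (I \<union> set (take i as))) \<and>
     ideal_gen (I \<union> set as) \<noteq> UNIV"

text \<open>\<open>depth_quotient A I\<close> is the depth of \<open>R/I\<close> with respect to the ideal \<open>A\<close>
  (meaningful when \<open>I\<close> and \<open>A\<close> lie in a common proper ideal).\<close>

definition depth_quotient :: "'a::comm_ring_1 set \<Rightarrow> 'a set \<Rightarrow> enat" where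
  "depth_quotient A I =
     Sup {enat (length as) | as. set as \<subseteq> A \<and> regular_sequence_on_quotient I as}"

text \<open>Rank over the domain \<open>R/P\<close> (equivalently, over its field of fractions) of the matrix with
  the given rows: the largest number of rows that are linearly independent modulo \<open>P\<close>. Subsets
  of row positions are used so that repeated rows count as dependent.\<close>

definition rows_independent_mod ::
    "'a::comm_ring_1 set \<Rightarrow> ('n \<Rightarrow> 'a) list \<Rightarrow> nat set \<Rightarrow> bool" where
  "rows_independent_mod P rows S \<longleftrightarrow>
     (\<forall>c. (\<forall>j. (\<Sum>i\<in>S. c i * (rows ! i) j) \<in> P) \<longrightarrow> (\<forall>i\<in>S. c i \<in> P))"

definition rank_mod :: "'a::comm_ring_1 set \<Rightarrow> ('n \<Rightarrow> 'a) list \<Rightarrow> nat" where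
  "rank_mod P rows = Max {card S | S. S \<subseteq> {..<length rows} \<and> rows_independent_mod P rows S}"


section \<open>The polynomial ring\<close>

text \<open>Polynomials in variables indexed by \<open>'n\<close> with coefficients in \<open>'k\<close>: finitely supported
  functions on exponent vectors, with the convolution product of \<open>Poly_Mapping\<close>.\<close>

type_synonym ('n, 'k) mpoly = "('n \<Rightarrow>\<^sub>0 nat) \<Rightarrow>\<^sub>0 'k"

definition mvar :: "'n \<Rightarrow> ('n, 'k::comm_ring_1) mpoly" where
  "mvar i = Poly_Mapping.single (Poly_Mapping.single i 1) 1"

definition mdeg :: "('n::finite \<Rightarrow>\<^sub>0 nat) \<Rightarrow> nat" where
  "mdeg m = (\<Sum>i\<in>UNIV. Poly_Mapping.lookup m i)"

text \<open>The zero polynomial is homogeneous of every degree.\<close>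

definition homogeneous :: "nat \<Rightarrow> ('n::finite, 'k::comm_ring_1) mpoly \<Rightarrow> bool" where
  "homogeneous d p \<longleftrightarrow> (\<forall>m\<in>Poly_Mapping.keys p. mdeg m = d)"

text \<open>Exponent subtraction below truncates only for terms whose new coefficient is 0.\<close>

definition pd :: "'n \<Rightarrow> ('n, 'k::comm_ring_1) mpoly \<Rightarrow> ('n, 'k) mpoly" where
  "pd i p = (\<Sum>m\<in>Poly_Mapping.keys p.
     Poly_Mapping.single (m - Poly_Mapping.single i 1)
       (of_nat (Poly_Mapping.lookup m i) * Poly_Mapping.lookup p m))"

definition max_ideal :: "('n::finite, 'k::comm_ring_1) mpoly set" where
  "max_ideal = ideal_gen (range mvar)"

definition homogeneous_ideal :: "('n::finite, 'k::comm_ring_1) mpoly set \<Rightarrow> bool" where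
  "homogeneous_ideal I \<longleftrightarrow> is_ideal I \<and> I = ideal_gen {p \<in> I. \<exists>d. homogeneous d p}"

definition jacobian_ideal :: "('n::finite, 'k::comm_ring_1) mpoly \<Rightarrow> ('n, 'k) mpoly set" where
  "jacobian_ideal h = ideal_gen (range (\<lambda>i. pd i h))"

definition jacobian_matrix ::
    "('n::finite, 'k::comm_ring_1) mpoly list \<Rightarrow> ('n \<Rightarrow> ('n, 'k) mpoly) list" where
  "jacobian_matrix hs = map (\<lambda>h i. pd i h) hs"

text \<open>Smoothness over the base field of the hypersurface \<open>Proj (R/(h))\<close>: the Jacobian matrix
  has rank 1 at each of its points, that is, at each homogeneous prime containing \<open>h\<close> but not the
  irrelevant ideal. If the characteristic does not divide the degree of \<open>h\<close>, then \<open>h\<close> lies in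
  its Jacobian ideal by Euler's formula, and for degree at least 2 the condition says that the
  Jacobian ideal is primary to \<open>max_ideal\<close>.\<close>

definition smooth_form :: "('n::finite, 'k::field) mpoly \<Rightarrow> bool" where
  "smooth_form h \<longleftrightarrow>
     (\<forall>P. prime_ideal P \<and> homogeneous_ideal P \<and> \<not> max_ideal \<subseteq> P \<and> h \<in> P \<longrightarrow> (\<exists>i. pd i h \<notin> P))"

text \<open>The syzygies of the partial derivatives of \<open>h\<close>, i.e. Syz(J_h).\<close>

definition jacobian_syz :: "('n::finite, 'k::comm_ring_1) mpoly \<Rightarrow> ('n \<Rightarrow> ('n, 'k) mpoly) set" where
  "jacobian_syz h = {P. (\<Sum>i\<in>UNIV. P i * pd i h) = 0}"

text \<open>Least degree of a nonzero homogeneous element, and \<open>\<infinity>\<close> if there is none.\<close>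

definition indeg :: "('n::finite \<Rightarrow> ('n, 'k::comm_ring_1) mpoly) set \<Rightarrow> enat" where
  "indeg M = Inf {enat r | r. \<exists>P\<in>M. (\<exists>i. P i \<noteq> 0) \<and> (\<forall>i. homogeneous r (P i))}"

definition no_common_factor :: "'a::comm_ring_1 \<Rightarrow> 'a \<Rightarrow> bool" where
  "no_common_factor a b \<longleftrightarrow> (\<forall>c. c dvd a \<longrightarrow> c dvd b \<longrightarrow> c dvd 1)"

end

theory Submission
  imports Defs
begin

text \<open>
  Write \<open>F = fg\<close>, let subscripts denote partial derivatives, and let \<open>J\<close> be the Jacobian ideal of \<open>F\<close>.
  Everything rests on the product rule \<open>F\<^sub>i = f\<^sub>i g + f g\<^sub>i\<close> and Euler's formula, which puts \<open>F\<close> into \<open>J\<close>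
  if the characteristic does not divide \<open>d + e\<close>.

  The first part follows at once: \<open>f\<^sub>i g\<^sup>2 = g F\<^sub>i - F g\<^sub>i\<close> lies in \<open>J\<close>, and the ideal of the \<open>f\<^sub>i\<close> contains
  a power of the irrelevant ideal because \<open>f\<close> is smooth. Smoothness speaks of homogeneous
  primes; Krull's construction of prime ideals, in a graded form, leads from there to powers
  (\<open>order_ge_subset_if_no_graded_primes\<close>).

  For the second part, regard a syzygy of the \<open>F\<^sub>i\<close> as a derivation that kills \<open>fg\<close>. Since \<open>f\<close> and \<open>g\<close> are
  coprime, it maps \<open>g\<close> to a multiple \<open>q g\<close>, and subtracting \<open>q / e\<close> times the Euler derivation gives a
  nonzero syzygy of the \<open>g\<^sub>i\<close> of the same degree (\<open>jacobian_syz_of_factor\<close>). The conclusion from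
  coprimality needs unique factorization in polynomial rings, proved by adjoining one variable after
  the other with Gauss's lemma (\<open>no_common_factor_dvd_cancel\<close>). If \<open>g\<close> is smooth, the \<open>g\<^sub>i\<close> are as many
  forms as there are variables and generate an ideal that contains powers of all variables.
  The Koszul complex of such forms is exact, so that the entries of a syzygy lie in the ideal of the
  \<open>g\<^sub>i\<close> and have degree at least \<open>e - 1\<close> (\<open>koszul_exact\<close>, \<open>syzygy_degree\<close>).

  For the third part, it suffices that \<open>g\<close> lies in the saturation of \<open>J\<close>: it does not lie in \<open>J\<close> for
  reasons of degree, and therefore no element of the irrelevant ideal is a nonzerodivisor modulo
  \<open>J\<close>. By Cramer's rule, \<open>(f\<^sub>i g\<^sub>j - f\<^sub>j g\<^sub>i) g\<close> is a combination of \<open>F\<^sub>i\<close> and \<open>F\<^sub>j\<close>, so that \<open>J : g\<close> contains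
  the minors of the Jacobian matrix besides \<open>f\<close> and the \<open>f\<^sub>i g\<close>. A homogeneous prime above \<open>J : g\<close> that
  is not irrelevant would contain \<open>f\<close>, then \<open>g\<close> because \<open>f\<close> is smooth, and all the minors.
  It is contained in the prime \<open>Q\<close> of a closed point (\<open>graded_prime_of_point\<close>), which has
  height \<open>n - 1\<close> (\<open>height_of_point\<close>), and this contradicts the rank condition. The height requires
  some dimension theory: \<open>n + 1\<close> polynomials are algebraically dependent by a count of monomials, whereas
  elements chosen along a chain of primes are independent (\<open>prime_chain_length\<close>). In the other
  direction, a chain below \<open>Q\<close> arises by contracting \<open>Q\<close> to fewer and fewer variables.
\<close>

abbreviation lookup where "lookup \<equiv> Poly_Mapping.lookup"
abbreviation keys where "keys \<equiv> Poly_Mapping.keys"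
abbreviation single where "single \<equiv> Poly_Mapping.single"

section \<open>Ideals\<close>

lemma is_ideal_iff:
  "is_ideal I \<longleftrightarrow> 0 \<in> I \<and> (\<forall>x\<in>I. \<forall>y\<in>I. x + y \<in> I) \<and> (\<forall>c. \<forall>x\<in>I. c * x \<in> I)"
  unfolding is_ideal_def module.subspace_def[OF module_times] by blast

lemma is_idealI:
  assumes "0 \<in> I" "\<And>x y. x \<in> I \<Longrightarrow> y \<in> I \<Longrightarrow> x + y \<in> I" "\<And>c x. x \<in> I \<Longrightarrow> c * x \<in> I"
  shows "is_ideal I"
  using assms by (auto simp: is_ideal_iff)

lemma ideal_zero: "is_ideal I \<Longrightarrow> 0 \<in> I"
  and ideal_add: "is_ideal I \<Longrightarrow> x \<in> I \<Longrightarrow> y \<in> I \<Longrightarrow> x + y \<in> I"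
  and ideal_mult: "is_ideal I \<Longrightarrow> x \<in> I \<Longrightarrow> c * x \<in> I"
  by (auto simp: is_ideal_iff)

lemma ideal_mult_right: "is_ideal I \<Longrightarrow> x \<in> I \<Longrightarrow> x * c \<in> I"
  using ideal_mult[of I x c] by (simp add: mult.commute)

lemma ideal_uminus: "is_ideal I \<Longrightarrow> x \<in> I \<Longrightarrow> - x \<in> I"
  using ideal_mult[of I x "-1"] by simp

lemma ideal_diff: "is_ideal I \<Longrightarrow> x \<in> I \<Longrightarrow> y \<in> I \<Longrightarrow> x - y \<in> I"
  using ideal_add[of I x "- y"] ideal_uminus[of I y] by simp

lemma ideal_sum: "is_ideal I \<Longrightarrow> (\<And>i. i \<in> A \<Longrightarrow> f i \<in> I) \<Longrightarrow> sum f A \<in> I"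
  by (induction A rule: infinite_finite_induct) (auto simp: ideal_zero ideal_add)

lemma ideal_add_cancel: "is_ideal I \<Longrightarrow> x + y \<in> I \<Longrightarrow> y \<in> I \<Longrightarrow> x \<in> I"
  using ideal_diff[of I "x + y" y] by simp

lemma is_ideal_gen: "is_ideal (ideal_gen S)"
  unfolding is_ideal_def ideal_gen_def by (rule module.subspace_span[OF module_times])

lemma ideal_gen_base: "a \<in> S \<Longrightarrow> a \<in> ideal_gen S"
  unfolding ideal_gen_def by (rule module.span_base[OF module_times])

lemma ideal_gen_superset: "S \<subseteq> ideal_gen S"
  by (rule subsetI) (rule ideal_gen_base)

lemma ideal_gen_least: "S \<subseteq> I \<Longrightarrow> is_ideal I \<Longrightarrow> ideal_gen S \<subseteq> I"
  unfolding ideal_gen_def is_ideal_def by (rule module.span_minimal[OF module_times])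

lemma ideal_gen_eq: "is_ideal I \<Longrightarrow> ideal_gen I = I"
  using ideal_gen_least[of I I] ideal_gen_base[of _ I] by blast

lemma ideal_gen_rangeE:
  fixes h :: "'i::finite \<Rightarrow> 'a::comm_ring_1"
  assumes "x \<in> ideal_gen (range h)"
  obtains a where "x = (\<Sum>i\<in>UNIV. a i * h i)"
proof -
  let ?I = "{x. \<exists>a. x = (\<Sum>i\<in>UNIV. a i * h i)}"
  have "is_ideal ?I"
  proof (rule is_idealI)
    show "0 \<in> ?I" by (auto intro: exI[of _ "\<lambda>_. 0"])
  next
    fix x y assume "x \<in> ?I" "y \<in> ?I"
    then obtain a b where "x = (\<Sum>i\<in>UNIV. a i * h i)" "y = (\<Sum>i\<in>UNIV. b i * h i)" by blast
    then show "x + y \<in> ?I"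
      by (auto intro!: exI[of _ "\<lambda>i. a i + b i"] simp: distrib_right sum.distrib)
  next
    fix c x assume "x \<in> ?I"
    then obtain a where "x = (\<Sum>i\<in>UNIV. a i * h i)" by blast
    then show "c * x \<in> ?I"
      by (auto intro!: exI[of _ "\<lambda>i. c * a i"] simp: sum_distrib_left mult.assoc)
  qed
  moreover have "h i \<in> ?I" for i
    by (auto intro!: exI[of _ "\<lambda>j. if j = i then 1 else 0"] simp: if_distrib[of "\<lambda>x. x * _"] cong: if_cong)
  ultimately have "ideal_gen (range h) \<subseteq> ?I" by (intro ideal_gen_least) auto
  with assms that show thesis by blast
qed

lemma ideal_gen_insertE:
  assumes "is_ideal I" "x \<in> ideal_gen (insert a I)"
  obtains q s where "q \<in> I" "x = q + s * a"
proof -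
  let ?J = "{x. \<exists>q s. q \<in> I \<and> x = q + s * a}"
  have "is_ideal ?J"
  proof (rule is_idealI)
    show "0 \<in> ?J" using ideal_zero[OF assms(1)] by (auto intro!: exI[of _ 0])
  next
    fix x y assume "x \<in> ?J" "y \<in> ?J"
    then obtain q s q' s' where "q \<in> I" "x = q + s * a" "q' \<in> I" "y = q' + s' * a" by blast
    then have "q + q' \<in> I" "x + y = (q + q') + (s + s') * a"
      using ideal_add[OF assms(1)] by (auto simp: algebra_simps)
    then show "x + y \<in> ?J" by blast
  next
    fix c x assume "x \<in> ?J"
    then obtain q s where "q \<in> I" "x = q + s * a" by blast
    then have "c * q \<in> I" "c * x = c * q + (c * s) * a"
      using ideal_mult[OF assms(1), of q c] by (auto simp: distrib_left mult.assoc)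
    then show "c * x \<in> ?J" by blast
  qed
  moreover have "a \<in> ?J"
    using ideal_zero[OF assms(1)] by (intro CollectI exI[of _ 0] exI[of _ 1]) simp
  moreover have "I \<subseteq> ?J"
  proof
    fix x assume "x \<in> I"
    then show "x \<in> ?J" by (intro CollectI exI[of _ x] exI[of _ 0]) simp
  qed
  ultimately have "ideal_gen (insert a I) \<subseteq> ?J" by (intro ideal_gen_least) auto
  with assms that show thesis by blast
qed

lemma prime_idealD: "prime_ideal P \<Longrightarrow> a * b \<in> P \<Longrightarrow> a \<in> P \<or> b \<in> P"
  and prime_ideal_ideal: "prime_ideal P \<Longrightarrow> is_ideal P"
  and prime_ideal_one: "prime_ideal P \<Longrightarrow> 1 \<notin> P"
  by (auto simp: prime_ideal_def)

lemma prime_ideal_powerD: "prime_ideal P \<Longrightarrow> a ^ k \<in> P \<Longrightarrow> a \<in> P"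
  by (induction k) (auto dest: prime_idealD simp: prime_ideal_one)

section \<open>Monomials and gradings\<close>

lemma mpoly_expand:
  assumes "finite A" "keys p \<subseteq> A"
  shows "p = (\<Sum>m\<in>A. single m (lookup p m))"
proof (rule poly_mapping_eqI)
  fix k
  have "(\<Sum>m\<in>A. lookup (single m (lookup p m)) k) = (\<Sum>m\<in>A. if m = k then lookup p k else 0)"
    by (intro sum.cong) (auto simp: lookup_single)
  also have "\<dots> = lookup p k" using assms
    by (auto simp: sum.delta in_keys_iff)
  finally show "lookup p k = lookup (\<Sum>m\<in>A. single m (lookup p m)) k"
    by (simp add: lookup_sum)
qed

lemma mpoly_induct [case_names zero add]:
  fixes p :: "'a \<Rightarrow>\<^sub>0 'b::comm_monoid_add"
  assumes "P 0" "\<And>p m c. P p \<Longrightarrow> P (single m c + p)"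
  shows "P p"
proof -
  have "P (\<Sum>m\<in>A. single m (lookup p m))" if "finite A" for A
    using that by induction (auto intro: assms)
  then show ?thesis using mpoly_expand[of "keys p" p] by (metis finite_keys order_refl)
qed

lemma lookup_single_mult_add:
  fixes p :: "('n, 'k::comm_ring_1) mpoly"
  shows "lookup (single t c * p) (t + m) = c * lookup p m"
  by (induction p rule: mpoly_induct)
    (auto simp: distrib_left lookup_add mult_single lookup_single "when_def")

lemma lookup_single_mult_0:
  fixes p :: "('n, 'k::comm_ring_1) mpoly"
  assumes "\<And>m'. m \<noteq> t + m'"
  shows "lookup (single t c * p) m = 0"
  by (induction p rule: mpoly_induct)
    (use assms in \<open>auto simp: distrib_left lookup_add mult_single lookup_single "when_def"\<close>)

lemma keys_single_mult:
  fixes p :: "('n, 'k::comm_ring_1) mpoly"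
  shows "keys (single t 1 * p) = (+) t ` keys p"
proof (intro set_eqI iffI)
  fix m assume "m \<in> keys (single t 1 * p)"
  then obtain m' where "m = t + m'" using lookup_single_mult_0[of m t 1 p] by (auto simp: in_keys_iff)
  with \<open>m \<in> _\<close> show "m \<in> (+) t ` keys p" by (auto simp: in_keys_iff lookup_single_mult_add)
qed (auto simp: in_keys_iff lookup_single_mult_add)

lemma exponent_split: "(t::nat) \<le> lookup m i \<Longrightarrow> m = single i t + (m - single i t)"
  by (rule poly_mapping_eqI) (auto simp: lookup_add lookup_minus lookup_single "when_def")

lemma mvar_power: "mvar i ^ k = single (single i k) (1::'k::comm_ring_1)"
  by (induction k) (auto simp: mvar_def mult_single simp flip: single_add)

lemma mdeg_zero [simp]: "mdeg 0 = 0"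
  and mdeg_add: "mdeg (a + b) = mdeg a + mdeg b"
  and mdeg_single [simp]: "mdeg (single i k) = k"
  by (auto simp: mdeg_def lookup_add sum.distrib lookup_single "when_def")

lemma mdeg_eq_0_iff [simp]: "mdeg m = 0 \<longleftrightarrow> m = 0"
  by (auto simp: mdeg_def poly_mapping_eq_iff fun_eq_iff)

text \<open>A grading \<open>\<delta>\<close> of the exponent vectors turns a polynomial into a univariate one over the
  polynomial ring, with its components as coefficients; \<open>\<rho>\<close> says what remains of an exponent vector
  in its coefficient. If \<open>\<rho>\<close> and \<open>\<delta>\<close> are additive, this is a ring homomorphism, so that the library
  on univariate polynomials (coefficients of products, degrees) becomes available. Both the
  decomposition into homogeneous components and the view of a polynomial as one in a single variable
  are of this kind.\<close>

definition regrade ::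
  "(('n \<Rightarrow>\<^sub>0 nat) \<Rightarrow> ('n \<Rightarrow>\<^sub>0 nat)) \<Rightarrow> (('n \<Rightarrow>\<^sub>0 nat) \<Rightarrow> nat)
    \<Rightarrow> ('n, 'k::comm_ring_1) mpoly \<Rightarrow> ('n, 'k) mpoly poly" where
  "regrade \<rho> \<delta> p = (\<Sum>m\<in>keys p. monom (single (\<rho> m) (lookup p m)) (\<delta> m))"

lemma regrade_superset:
  "finite A \<Longrightarrow> keys p \<subseteq> A \<Longrightarrow> regrade \<rho> \<delta> p = (\<Sum>m\<in>A. monom (single (\<rho> m) (lookup p m)) (\<delta> m))"
  unfolding regrade_def by (rule sum.mono_neutral_left) (auto simp: in_keys_iff)

lemma regrade_zero [simp]: "regrade \<rho> \<delta> 0 = 0"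
  by (simp add: regrade_def)

lemma regrade_single: "regrade \<rho> \<delta> (single m c) = monom (single (\<rho> m) c) (\<delta> m)"
  by (subst regrade_superset[of "{m}"]) auto

lemma regrade_add: "regrade \<rho> \<delta> (p + q) = regrade \<rho> \<delta> p + regrade \<rho> \<delta> q"
proof -
  let ?A = "keys p \<union> keys q"
  have "keys (p + q) \<subseteq> ?A" by (rule keys_add)
  then show ?thesis
    by (simp add: regrade_superset[of ?A] lookup_add single_add add_monom flip: sum.distrib)
qed

lemma regrade_sum: "regrade \<rho> \<delta> (sum f A) = (\<Sum>i\<in>A. regrade \<rho> \<delta> (f i))"
  by (induction A rule: infinite_finite_induct) (auto simp: regrade_add)

lemma regrade_mult:
  assumes "\<And>a b. \<rho> (a + b) = \<rho> a + \<rho> b" "\<And>a b. \<delta> (a + b) = \<delta> a + \<delta> b"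
  shows "regrade \<rho> \<delta> (p * q) = regrade \<rho> \<delta> p * regrade \<rho> \<delta> q"
proof (induction p rule: mpoly_induct)
  case (add p m c)
  have "regrade \<rho> \<delta> (single m c * q) = regrade \<rho> \<delta> (single m c) * regrade \<rho> \<delta> q"
    by (induction q rule: mpoly_induct)
      (simp_all add: distrib_left regrade_add mult_single regrade_single assms mult_monom)
  with add show ?case by (simp add: distrib_right regrade_add)
qed simp

lemma coeff_regrade:
  "coeff (regrade \<rho> \<delta> p) k = (\<Sum>m\<in>{m\<in>keys p. \<delta> m = k}. single (\<rho> m) (lookup p m))"
proof -
  have "coeff (regrade \<rho> \<delta> p) k = (\<Sum>m\<in>keys p. if \<delta> m = k then single (\<rho> m) (lookup p m) else 0)"
    unfolding regrade_def coeff_sum by (intro sum.cong) auto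
  also have "\<dots> = (\<Sum>m\<in>{m\<in>keys p. \<delta> m = k}. single (\<rho> m) (lookup p m))"
    by (simp add: sum.inter_filter)
  finally show ?thesis .
qed

subsection \<open>Homogeneous components\<close>

definition hpoly :: "('n::finite, 'k::comm_ring_1) mpoly \<Rightarrow> ('n, 'k) mpoly poly" where
  "hpoly = regrade id mdeg"

abbreviation hcomp :: "nat \<Rightarrow> ('n::finite, 'k::comm_ring_1) mpoly \<Rightarrow> ('n, 'k) mpoly" where
  "hcomp k p \<equiv> coeff (hpoly p) k"

lemma lookup_hcomp: "lookup (hcomp k p) m = (if mdeg m = k then lookup p m else 0)"
proof -
  have "lookup (hcomp k p) m = (\<Sum>m'\<in>{m'\<in>keys p. mdeg m' = k}. if m' = m then lookup p m else 0)"
    unfolding hpoly_def coeff_regrade lookup_sum by (intro sum.cong) (auto simp: lookup_single)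
  also have "\<dots> = (if mdeg m = k then lookup p m else 0)"
    by (auto simp: sum.delta in_keys_iff)
  finally show ?thesis .
qed

lemma hpoly_zero [simp]: "hpoly 0 = 0"
  and hpoly_add: "hpoly (p + q) = hpoly p + hpoly q"
  and hpoly_mult: "hpoly (p * q) = hpoly p * hpoly q"
  by (simp_all add: hpoly_def regrade_add regrade_mult mdeg_add)

lemma homogeneous_hcomp [simp]: "homogeneous k (hcomp k p)"
  by (auto simp: homogeneous_def in_keys_iff lookup_hcomp split: if_splits)

lemma hpoly_homogeneous: "homogeneous d p \<Longrightarrow> hpoly p = monom p d"
  by (rule poly_eqI, rule poly_mapping_eqI)
    (auto simp: lookup_hcomp homogeneous_def in_keys_iff)

lemma hcomp_homogeneous: "homogeneous d p \<Longrightarrow> hcomp k p = (if k = d then p else 0)"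
  by (auto simp: hpoly_homogeneous)

lemma poly_hpoly_1: "poly (hpoly p) 1 = p"
proof (induction p rule: mpoly_induct)
  case (add p m c)
  then show ?case by (simp add: hpoly_add) (simp add: hpoly_def regrade_single poly_monom)
qed simp

lemma sum_hcomp: "p = (\<Sum>k\<le>degree (hpoly p). hcomp k p)"
  using poly_hpoly_1[of p] by (simp add: poly_altdef)

lemma homogeneous_zero [simp]: "homogeneous d 0"
  by (simp add: homogeneous_def)

lemma homogeneous_add: "homogeneous d p \<Longrightarrow> homogeneous d q \<Longrightarrow> homogeneous d (p + q)"
  unfolding homogeneous_def using keys_add[of p q] by blast

lemma homogeneous_mult: "homogeneous d p \<Longrightarrow> homogeneous e q \<Longrightarrow> homogeneous (d + e) (p * q)"
  unfolding homogeneous_def using keys_mult[of p q] by (fastforce simp: mdeg_add)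

lemma homogeneous_mvar: "homogeneous 1 (mvar i)"
  by (simp add: homogeneous_def mvar_def)

subsection \<open>Coefficients with respect to one variable\<close>

definition upoly :: "'n \<Rightarrow> ('n, 'k::comm_ring_1) mpoly \<Rightarrow> ('n, 'k) mpoly poly" where
  "upoly i = regrade (\<lambda>m. m - single i (lookup m i)) (\<lambda>m. lookup m i)"

lemma upoly_zero [simp]: "upoly i 0 = 0"
  and upoly_add: "upoly i (p + q) = upoly i p + upoly i q"
  and upoly_sum: "upoly i (sum f A) = (\<Sum>j\<in>A. upoly i (f j))"
  by (simp_all add: upoly_def regrade_add regrade_sum)

lemma upoly_mult: "upoly i (p * q) = upoly i p * upoly i q"
  unfolding upoly_def
  by (rule regrade_mult)
    (auto simp: lookup_add lookup_minus lookup_single "when_def" intro!: poly_mapping_eqI)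

lemma upoly_single: "upoly i (single m c) = monom (single (m - single i (lookup m i)) c) (lookup m i)"
  by (simp add: upoly_def regrade_single)

lemma poly_upoly: "poly (upoly i p) (mvar i) = p"
proof (induction p rule: mpoly_induct)
  case (add p m c)
  have "single (m - single i (lookup m i)) c * mvar i ^ lookup m i = single m c"
    using exponent_split[of "lookup m i" m i] by (simp add: mvar_power mult_single add.commute)
  with add show ?case by (simp add: upoly_add upoly_single poly_monom)
qed simp

lemma upoly_uminus: "upoly i (- p) = - upoly i p"
  using upoly_add[of i p "- p"] by (simp add: add_eq_0_iff)

lemma upoly_diff: "upoly i (p - q) = upoly i p - upoly i q"
  using upoly_add[of i p "- q"] by (simp add: upoly_uminus)

lemma upoly_eq_0_iff [simp]: "upoly i p = 0 \<longleftrightarrow> p = 0"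
  using poly_upoly[of i p] by auto

definition polys_in :: "'n set \<Rightarrow> ('n, 'k::comm_ring_1) mpoly set" where
  "polys_in V = {p. \<forall>m\<in>keys p. keys m \<subseteq> V}"

lemma upoly_polys_in: "p \<in> polys_in V \<Longrightarrow> i \<notin> V \<Longrightarrow> upoly i p = [:p:]"
proof -
  assume p: "p \<in> polys_in V" and i: "i \<notin> V"
  have "lookup m i = 0" if "m \<in> keys p" for m
    using p i that unfolding polys_in_def in_keys_iff[symmetric]
    by (metis (mono_tags, lifting) in_keys_iff mem_Collect_eq subsetD)
  then have "upoly i p = (\<Sum>m\<in>keys p. monom (single m (lookup p m)) 0)"
    unfolding upoly_def regrade_def by (intro sum.cong) auto
  also have "\<dots> = monom (\<Sum>m\<in>keys p. single m (lookup p m)) 0"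
    by (rule poly_eqI) (simp add: coeff_sum)
  finally show ?thesis using mpoly_expand[of "keys p" p] by (simp add: monom_0)
qed

section \<open>Partial derivatives\<close>

lemma pd_superset:
  "finite A \<Longrightarrow> keys p \<subseteq> A \<Longrightarrow>
    pd i p = (\<Sum>m\<in>A. single (m - single i 1) (of_nat (lookup m i) * lookup p m))"
  unfolding pd_def by (rule sum.mono_neutral_left) (auto simp: in_keys_iff)

lemma pd_zero [simp]: "pd i 0 = 0"
  by (simp add: pd_def)

lemma pd_add: "pd i (p + q) = pd i p + pd i q"
proof -
  let ?A = "keys p \<union> keys q"
  have "keys (p + q) \<subseteq> ?A" by (rule keys_add)
  then show ?thesis
    by (simp add: pd_superset[of ?A] lookup_add single_add distrib_left flip: sum.distrib)
qed

lemma pd_single: "pd i (single m c) = single (m - single i 1) (of_nat (lookup m i) * c)"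
  by (subst pd_superset[of "{m}"]) auto

lemma pd_mult_single:
  "pd i (single m c * single m' c')
     = pd i (single m c) * single m' c' + single m c * pd i (single m' c')"
proof -
  have shift: "single (m - single i 1 + m') (of_nat (lookup m i) * b)
      = single (m + m' - single i 1) (of_nat (lookup m i) * b)" for b :: 'b and m m' :: "'a \<Rightarrow>\<^sub>0 nat"
  proof (cases "lookup m i = 0")
    case False
    then have "m - single i 1 + m' = m + m' - single i 1"
      by (intro poly_mapping_eqI) (auto simp: lookup_add lookup_minus lookup_single "when_def")
    then show ?thesis by simp
  qed simp
  have "pd i (single m c) * single m' c' = single (m + m' - single i 1) (of_nat (lookup m i) * (c * c'))"
    using shift[of m m' "c * c'"] by (simp add: pd_single mult_single mult.assoc)
  moreover have "single m c * pd i (single m' c')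
      = single (m + m' - single i 1) (of_nat (lookup m' i) * (c * c'))"
    using shift[of m' m "c * c'"] by (simp add: pd_single mult_single mult_ac add.commute)
  ultimately show ?thesis
    by (simp add: mult_single pd_single lookup_add algebra_simps single_add flip: single_add)
qed

lemma pd_mult: "pd i (p * q) = pd i p * q + p * pd i q"
proof (induction p rule: mpoly_induct)
  case (add p m c)
  have "pd i (single m c * q) = pd i (single m c) * q + single m c * pd i q"
    by (induction q rule: mpoly_induct) (simp_all add: distrib_left pd_add pd_mult_single)
  with add show ?case by (simp add: distrib_right pd_add)
qed simp

lemma euler_single: "(\<Sum>i\<in>UNIV. mvar i * pd i (single m c)) = of_nat (mdeg m) * single m c"
proof -
  have "mvar i * pd i (single m c) = of_nat (lookup m i) * single m c" for i
  proof (cases "lookup m i = 0")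
    case False
    then have "single i 1 + (m - single i 1) = m" using exponent_split[of 1 m i] by simp
    then show ?thesis by (simp add: pd_single mvar_def mult_single flip: single_of_nat)
  qed (simp add: pd_single)
  then show ?thesis by (simp add: mdeg_def sum_distrib_right)
qed

lemma euler:
  fixes p :: "('n::finite, 'k::comm_ring_1) mpoly"
  assumes "homogeneous d p"
  shows "(\<Sum>i\<in>UNIV. mvar i * pd i p) = of_nat d * p"
proof -
  have "(\<Sum>i\<in>UNIV. mvar i * pd i (\<Sum>m\<in>A. single m (lookup p m))) = of_nat d * (\<Sum>m\<in>A. single m (lookup p m))"
    if "finite A" "A \<subseteq> keys p" for A
    using that
  proof induction
    case (insert m A)
    then have "mdeg m = d" using assms by (auto simp: homogeneous_def)
    with insert show ?case
      by (simp add: pd_add distrib_left sum.distrib euler_single)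
  qed simp
  from this[of "keys p"] show ?thesis using mpoly_expand[of "keys p" p] by simp
qed

lemma homogeneous_pd:
  assumes "homogeneous d p" shows "homogeneous (d - 1) (pd i p)"
proof -
  have "mdeg m' = d - 1" if "m' \<in> keys (pd i p)" for m'
  proof -
    have "lookup (pd i p) m' \<noteq> 0" using that by (simp add: in_keys_iff)
    then obtain m where m: "m \<in> keys p"
      "lookup (single (m - single i 1) (of_nat (lookup m i) * lookup p m)) m' \<noteq> 0"
      unfolding pd_def lookup_sum by (meson sum.not_neutral_contains_not_neutral)
    have "lookup m i \<noteq> 0" using m(2) by (cases "lookup m i = 0") auto
    moreover have "m' = m - single i 1"
      using m(2) by (auto simp: lookup_single "when_def" split: if_splits)
    ultimately have "m = single i 1 + m'"
      using exponent_split[of 1 m i] by simp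
    then have "mdeg m = 1 + mdeg m'" using mdeg_add[of "single i 1" m'] by simp
    then show ?thesis using assms m(1) by (auto simp: homogeneous_def)
  qed
  then show ?thesis by (simp add: homogeneous_def)
qed

section \<open>Homogeneous ideals\<close>

text \<open>This is the \<open>N\<close>-th power of the irrelevant ideal, described by terms instead of products; all
  statements on powers of the irrelevant ideal are reduced to it.\<close>

definition order_ge :: "nat \<Rightarrow> ('n::finite, 'k::comm_ring_1) mpoly set" where
  "order_ge N = {p. \<forall>m\<in>keys p. N \<le> mdeg m}"

lemma order_ge_mult:
  assumes "p \<in> order_ge M" "q \<in> order_ge N" shows "p * q \<in> order_ge (M + N)"
  using assms keys_mult[of p q] by (fastforce simp: order_ge_def mdeg_add)

lemma order_ge_0 [simp]: "order_ge 0 = UNIV"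
  by (auto simp: order_ge_def)

lemma is_ideal_order_ge: "is_ideal (order_ge N)"
proof (rule is_idealI)
  fix x y :: "('a, 'b) mpoly" assume "x \<in> order_ge N" "y \<in> order_ge N"
  then show "x + y \<in> order_ge N" using keys_add[of x y] by (auto simp: order_ge_def)
next
  fix c x :: "('a, 'b) mpoly" assume "x \<in> order_ge N"
  then show "c * x \<in> order_ge N" using order_ge_mult[of c 0 x N] by simp
qed (simp add: order_ge_def)

lemma homogeneous_order_ge: "homogeneous d p \<Longrightarrow> N \<le> d \<Longrightarrow> p \<in> order_ge N"
  by (simp add: homogeneous_def order_ge_def)

lemma order_ge_homogeneous_zero: "homogeneous d p \<Longrightarrow> p \<in> order_ge N \<Longrightarrow> d < N \<Longrightarrow> p = 0"
  by (rule poly_mapping_eqI) (fastforce simp: homogeneous_def order_ge_def in_keys_iff)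

lemma max_ideal_subset: "is_ideal I \<Longrightarrow> (\<And>i. mvar i \<in> I) \<Longrightarrow> max_ideal \<subseteq> I"
  unfolding max_ideal_def by (rule ideal_gen_least) auto

lemma mvar_in_max_ideal: "mvar i \<in> max_ideal"
  unfolding max_ideal_def by (rule ideal_gen_base) simp

lemma max_ideal_order_ge: "max_ideal \<subseteq> order_ge 1"
  by (rule max_ideal_subset) (auto intro: is_ideal_order_ge homogeneous_order_ge homogeneous_mvar)

lemma prod_list_order_ge:
  "set as \<subseteq> order_ge 1 \<Longrightarrow> prod_list as \<in> order_ge (length as)"
proof (induction as)
  case (Cons a as)
  then show ?case using order_ge_mult[of a 1 "prod_list as" "length as"] by simp
qed simp

lemma ideal_power_max_ideal_order_ge: "ideal_power max_ideal N \<subseteq> order_ge N"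
  unfolding ideal_power_def using prod_list_order_ge max_ideal_order_ge
  by (intro ideal_gen_least is_ideal_order_ge) blast

lemma order_ge_subset:
  fixes J :: "('n::finite, 'k::comm_ring_1) mpoly set"
  assumes "is_ideal J" "\<And>m. mdeg m \<ge> N \<Longrightarrow> single m 1 \<in> J"
  shows "order_ge N \<subseteq> J"
proof
  fix p :: "('n, 'k) mpoly" assume p: "p \<in> order_ge N"
  have "single m (lookup p m) \<in> J" if "m \<in> keys p" for m
    using ideal_mult[OF assms(1) assms(2), of m "single 0 (lookup p m)"] p that
    by (auto simp: order_ge_def mult_single)
  then have "(\<Sum>m\<in>keys p. single m (lookup p m)) \<in> J"
    by (intro ideal_sum assms(1))
  then show "p \<in> J" using mpoly_expand[of "keys p" p] by simp
qed

text \<open>A monomial of degree at least \<open>\<Sum>k\<^sub>i\<close> has an exponent \<open>\<ge> k\<^sub>i\<close>.\<close>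

lemma order_ge_subset_if_powers:
  fixes J :: "('n::finite, 'k::comm_ring_1) mpoly set"
  assumes J: "is_ideal J" and pow: "\<And>i. \<exists>k. mvar i ^ k \<in> J"
  shows "\<exists>N. order_ge N \<subseteq> J"
proof -
  obtain k where k: "\<And>i. mvar i ^ k i \<in> J" using pow by metis
  have "order_ge (\<Sum>i\<in>UNIV. k i) \<subseteq> J"
  proof (cases "\<exists>i. k i = 0")
    case True
    then have "1 \<in> J" using k by (metis power_0)
    then show ?thesis using ideal_mult[OF J, of 1] by auto
  next
    case False
    show ?thesis
    proof (rule order_ge_subset[OF J])
      fix m :: "'n \<Rightarrow>\<^sub>0 nat" assume "(\<Sum>i\<in>UNIV. k i) \<le> mdeg m"
      then obtain i where i: "k i \<le> lookup m i"
        unfolding mdeg_def using sum_strict_mono[of UNIV "lookup m" k] by (metis UNIV_not_empty finite not_le)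
      have "single m (1::'k) = single (m - single i (k i)) 1 * mvar i ^ k i"
        using exponent_split[OF i] by (simp add: mvar_power mult_single add.commute)
      then show "single m (1::'k) \<in> J" using ideal_mult[OF J k] by simp
    qed
  qed
  then show ?thesis ..
qed

text \<open>Closure under taking components is the form of homogeneity that is easy to verify and to apply;
  it implies generation by homogeneous elements.\<close>

definition graded_ideal :: "('n::finite, 'k::comm_ring_1) mpoly set \<Rightarrow> bool" where
  "graded_ideal I \<longleftrightarrow> is_ideal I \<and> (\<forall>p\<in>I. \<forall>k. hcomp k p \<in> I)"

lemma graded_idealD: "graded_ideal I \<Longrightarrow> p \<in> I \<Longrightarrow> hcomp k p \<in> I"
  and graded_ideal_ideal: "graded_ideal I \<Longrightarrow> is_ideal I"
  by (auto simp: graded_ideal_def)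

lemma graded_ideal_homogeneous:
  assumes "graded_ideal I" shows "homogeneous_ideal I"
proof -
  let ?H = "{p \<in> I. \<exists>d. homogeneous d p}"
  have "p \<in> ideal_gen ?H" if "p \<in> I" for p
  proof -
    have "(\<Sum>k\<le>degree (hpoly p). hcomp k p) \<in> ideal_gen ?H"
      using graded_idealD[OF assms that]
      by (intro ideal_sum[OF is_ideal_gen] ideal_gen_base) (auto intro: homogeneous_hcomp)
    then show ?thesis using sum_hcomp[of p] by simp
  qed
  moreover have "ideal_gen ?H \<subseteq> I"
    using graded_ideal_ideal[OF assms] by (intro ideal_gen_least) auto
  ultimately show ?thesis
    unfolding homogeneous_ideal_def using graded_ideal_ideal[OF assms] by blast
qed

lemma graded_ideal_gen:
  assumes "\<And>p k. p \<in> S \<Longrightarrow> hcomp k p \<in> ideal_gen S"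
  shows "graded_ideal (ideal_gen S)"
proof -
  let ?I = "{p. \<forall>k. hcomp k p \<in> ideal_gen S}"
  have "is_ideal ?I"
  proof (rule is_idealI)
    fix c x assume x: "x \<in> ?I"
    have "hcomp k (c * x) \<in> ideal_gen S" for k
      unfolding hpoly_mult coeff_mult
      using x by (intro ideal_sum[OF is_ideal_gen] ideal_mult[OF is_ideal_gen]) auto
    then show "c * x \<in> ?I" by simp
  qed (auto simp: hpoly_add ideal_zero is_ideal_gen intro: ideal_add)
  then have "ideal_gen S \<subseteq> ?I" using assms by (intro ideal_gen_least) auto
  then show ?thesis by (auto simp: graded_ideal_def is_ideal_gen)
qed

lemma graded_ideal_gen_homogeneous:
  assumes "\<And>p. p \<in> S \<Longrightarrow> \<exists>d. homogeneous d p"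
  shows "graded_ideal (ideal_gen S)"
proof (rule graded_ideal_gen)
  fix p k assume "p \<in> S"
  moreover from this obtain d where "homogeneous d p" using assms by blast
  ultimately show "hcomp k p \<in> ideal_gen S"
    by (auto simp: hcomp_homogeneous is_ideal_gen intro: ideal_gen_base ideal_zero)
qed

lemma graded_ideal_gen_extend:
  assumes "graded_ideal I" "\<And>p. p \<in> S \<Longrightarrow> \<exists>d. homogeneous d p"
  shows "graded_ideal (ideal_gen (I \<union> S))"
proof (rule graded_ideal_gen)
  fix p k assume "p \<in> I \<union> S"
  then show "hcomp k p \<in> ideal_gen (I \<union> S)"
  proof
    assume "p \<in> I"
    then show ?thesis using graded_idealD[OF assms(1)] by (auto intro: ideal_gen_base)
  next
    assume "p \<in> S"
    then obtain d where "homogeneous d p" using assms(2) by blast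
    with \<open>p \<in> S\<close> show ?thesis
      by (auto simp: hcomp_homogeneous is_ideal_gen intro: ideal_gen_base ideal_zero)
  qed
qed

text \<open>If neither \<open>a\<close> nor \<open>b\<close> lies in \<open>P\<close>, let \<open>j\<close> and \<open>k\<close> be the lowest degrees of components outside \<open>P\<close>.
  Modulo \<open>P\<close>, the component of \<open>a b\<close> in degree \<open>j + k\<close> is the product of these two components.\<close>

lemma graded_ideal_prime:
  fixes P :: "('n::finite, 'k::comm_ring_1) mpoly set"
  assumes P: "graded_ideal P" and one: "1 \<notin> P"
    and hom: "\<And>a b j k. homogeneous j a \<Longrightarrow> homogeneous k b \<Longrightarrow> a * b \<in> P \<Longrightarrow> a \<in> P \<or> b \<in> P"
  shows "prime_ideal P"
proof -
  note I = graded_ideal_ideal[OF P]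
  have lowest: "\<exists>k. hcomp k a \<notin> P \<and> (\<forall>j<k. hcomp j a \<in> P)" if "a \<notin> P" for a :: "('n, 'k) mpoly"
  proof -
    have "\<exists>k. hcomp k a \<notin> P"
    proof (rule ccontr)
      assume "\<not> ?thesis"
      then have "(\<Sum>k\<le>degree (hpoly a). hcomp k a) \<in> P" by (intro ideal_sum[OF I]) auto
      with that show False using sum_hcomp[of a] by simp
    qed
    then show ?thesis using exists_least_iff[of "\<lambda>k. hcomp k a \<notin> P"] by blast
  qed
  have "a \<in> P \<or> b \<in> P" if ab: "a * b \<in> P" for a b
  proof (rule ccontr)
    assume "\<not> ?thesis"
    then obtain j k where j: "hcomp j a \<notin> P" "\<forall>i<j. hcomp i a \<in> P"
      and k: "hcomp k b \<notin> P" "\<forall>i<k. hcomp i b \<in> P" using lowest by metis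
    have "hcomp i a * hcomp (j + k - i) b \<in> P" if "i \<in> {..j + k} - {j}" for i
    proof (cases "i < j")
      case True
      then show ?thesis using j(2) by (intro ideal_mult_right[OF I]) auto
    next
      case False
      with that have "j + k - i < k" by auto
      then show ?thesis using k(2) by (intro ideal_mult[OF I]) auto
    qed
    then have "(\<Sum>i\<in>{..j + k} - {j}. hcomp i a * hcomp (j + k - i) b) \<in> P"
      by (intro ideal_sum[OF I])
    moreover have "hcomp (j + k) (a * b) = hcomp j a * hcomp k b
        + (\<Sum>i\<in>{..j + k} - {j}. hcomp i a * hcomp (j + k - i) b)"
      unfolding hpoly_mult coeff_mult by (subst sum.remove[of _ j]) auto
    moreover have "hcomp (j + k) (a * b) \<in> P" using graded_idealD[OF P ab] .
    ultimately have "hcomp j a * hcomp k b \<in> P" by (simp add: ideal_add_cancel[OF I])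
    then show False using hom[OF homogeneous_hcomp homogeneous_hcomp] j k by blast
  qed
  then show ?thesis unfolding prime_ideal_def using I one by blast
qed

lemma ideal_Union_chain:
  assumes "C \<noteq> {}" "subset.chain A C" "\<And>I. I \<in> A \<Longrightarrow> is_ideal I"
  shows "is_ideal (\<Union>C)"
proof (rule is_idealI)
  have C: "\<And>I. I \<in> C \<Longrightarrow> is_ideal I" using assms by (auto simp: subset_chain_def)
  show "0 \<in> \<Union>C" using assms(1) C by (auto intro: ideal_zero)
  fix x y assume "x \<in> \<Union>C" "y \<in> \<Union>C"
  then obtain I J where "I \<in> C" "J \<in> C" "x \<in> I" "y \<in> J" by blast
  moreover have "I \<subseteq> J \<or> J \<subseteq> I" using assms(2) \<open>I \<in> C\<close> \<open>J \<in> C\<close> by (auto simp: subset_chain_def)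
  ultimately show "x + y \<in> \<Union>C" using C ideal_add by blast
next
  fix c x assume "x \<in> \<Union>C"
  then obtain I where "I \<in> C" "x \<in> I" by blast
  moreover from this have "is_ideal I" using assms by (auto simp: subset_chain_def)
  ultimately show "c * x \<in> \<Union>C" using ideal_mult by blast
qed

text \<open>Krull's construction of prime ideals, in its graded form: a homogeneous ideal that is
  maximal among those avoiding the powers of a homogeneous element is prime.\<close>

lemma graded_prime_avoiding_powers:
  fixes J :: "('n::finite, 'k::comm_ring_1) mpoly set"
  assumes J: "graded_ideal J" and avoid: "\<And>k. x ^ k \<notin> J"
  obtains P where "prime_ideal P" "graded_ideal P" "J \<subseteq> P" "x \<notin> P"
proof -
  let ?A = "{I. graded_ideal I \<and> J \<subseteq> I \<and> (\<forall>k. x ^ k \<notin> I)}"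
  have "\<exists>M\<in>?A. \<forall>X\<in>?A. M \<subseteq> X \<longrightarrow> X = M"
  proof (rule subset_Zorn_nonempty)
    have "J \<in> ?A" using J avoid by simp
    then show "?A \<noteq> {}" by (metis empty_iff)
    fix C assume C: "C \<noteq> {}" "subset.chain ?A C"
    then have CA: "C \<subseteq> ?A" by (simp add: subset_chain_def)
    have "is_ideal (\<Union>C)" using C by (rule ideal_Union_chain) (auto dest: graded_ideal_ideal)
    moreover have "hcomp k p \<in> \<Union>C" if "p \<in> \<Union>C" for p k
    proof -
      obtain I where "I \<in> C" "p \<in> I" using \<open>p \<in> \<Union>C\<close> by blast
      moreover from this have "graded_ideal I" using CA by blast
      ultimately show ?thesis using graded_idealD by blast
    qed
    ultimately have "graded_ideal (\<Union>C)" by (simp add: graded_ideal_def)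
    moreover obtain I where "I \<in> C" using C(1) by blast
    then have "J \<subseteq> \<Union>C" using CA by blast
    ultimately show "\<Union>C \<in> ?A" using CA by blast
  qed
  then obtain P where "P \<in> ?A" and max': "\<forall>X\<in>?A. P \<subseteq> X \<longrightarrow> X = P" by blast
  then have P: "graded_ideal P" "J \<subseteq> P" "\<And>k. x ^ k \<notin> P" by auto
  have max: "I = P" if "graded_ideal I" "P \<subseteq> I" "\<And>k. x ^ k \<notin> I" for I
    using max' that order_trans[OF P(2) that(2)] by blast
  note I = graded_ideal_ideal[OF P(1)]
  have power: "\<exists>k q s. q \<in> P \<and> x ^ k = q + s * a" if a: "homogeneous j a" "a \<notin> P" for a j
  proof -
    let ?I = "ideal_gen (insert a P)"
    have "?I \<noteq> P" using a(2) ideal_gen_base[of a "insert a P"] by auto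
    moreover have "P \<subseteq> ?I" by (auto intro: ideal_gen_base)
    moreover have "graded_ideal ?I"
      using graded_ideal_gen_extend[OF P(1), of "{a}"] a by auto
    ultimately have "\<exists>k. x ^ k \<in> ?I" using max[of ?I] by blast
    then obtain k where "x ^ k \<in> ?I" ..
    then obtain q s where "q \<in> P" "x ^ k = q + s * a" by (rule ideal_gen_insertE[OF I])
    then show ?thesis by blast
  qed
  have "prime_ideal P"
  proof (rule graded_ideal_prime[OF P(1)])
    show "1 \<notin> P" using P(3)[of 0] by simp
    fix a b j k assume a: "homogeneous j a" and b: "homogeneous k b" and ab: "a * b \<in> P"
    show "a \<in> P \<or> b \<in> P"
    proof (rule ccontr)
      assume "\<not> ?thesis"
      then obtain k1 q1 s1 k2 q2 s2 where
        1: "q1 \<in> P" "x ^ k1 = q1 + s1 * a" and 2: "q2 \<in> P" "x ^ k2 = q2 + s2 * b"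
        using power[OF a] power[OF b] by blast
      have "x ^ (k1 + k2) = q1 * x ^ k2 + (s1 * a) * q2 + s1 * s2 * (a * b)"
        by (simp add: power_add 1 2 algebra_simps)
      also have "\<dots> \<in> P"
        by (intro ideal_add[OF I] ideal_mult[OF I] ideal_mult_right[OF I] 1 2 ab)
      finally show False using P(3) by blast
    qed
  qed
  moreover have "x \<notin> P" using P(3)[of 1] by simp
  ultimately show thesis using P(1,2) by (intro that)
qed

text \<open>The graded Nullstellensatz: a homogeneous ideal without projective zeros contains a power
  of the irrelevant ideal.\<close>

lemma order_ge_subset_if_no_graded_primes:
  fixes J :: "('n::finite, 'k::comm_ring_1) mpoly set"
  assumes J: "graded_ideal J"
    and primes: "\<And>P. prime_ideal P \<Longrightarrow> graded_ideal P \<Longrightarrow> J \<subseteq> P \<Longrightarrow> max_ideal \<subseteq> P"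
  shows "\<exists>N. order_ge N \<subseteq> J"
proof (rule order_ge_subset_if_powers[OF graded_ideal_ideal[OF J]])
  fix i
  show "\<exists>k. mvar i ^ k \<in> J"
  proof (rule ccontr)
    assume "\<not> ?thesis"
    then obtain P where "prime_ideal P" "graded_ideal P" "J \<subseteq> P" "mvar i \<notin> P"
      using graded_prime_avoiding_powers[OF J, of "mvar i"] by blast
    with primes show False using mvar_in_max_ideal by blast
  qed
qed

section \<open>Jacobian ideals\<close>

lemma is_ideal_jacobian [simp]: "is_ideal (jacobian_ideal h)"
  by (simp add: jacobian_ideal_def is_ideal_gen)

lemma pd_in_jacobian: "pd i h \<in> jacobian_ideal h"
  by (simp add: jacobian_ideal_def ideal_gen_base)

lemma jacobian_ideal_subset: "is_ideal I \<Longrightarrow> (\<And>i. pd i h \<in> I) \<Longrightarrow> jacobian_ideal h \<subseteq> I"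
  unfolding jacobian_ideal_def by (rule ideal_gen_least) auto

lemma graded_jacobian: "homogeneous d h \<Longrightarrow> graded_ideal (jacobian_ideal h)"
  unfolding jacobian_ideal_def by (rule graded_ideal_gen_homogeneous) (auto dest: homogeneous_pd)

lemma mpoly_of_nat_inverse:
  assumes "\<not> CHAR('k::field) dvd d"
  shows "single 0 (inverse (of_nat d)) * of_nat d = (1 :: ('n, 'k) mpoly)"
proof -
  have "(of_nat d :: ('n, 'k) mpoly) = single 0 (of_nat d)" by (rule single_of_nat[symmetric])
  then show ?thesis
    using assms by (simp only: mult_single) (simp add: of_nat_eq_0_iff_char_dvd)
qed

lemma form_in_ideal_if_pd_in_ideal:
  fixes h :: "('n::finite, 'k::field) mpoly"
  assumes "homogeneous d h" "\<not> CHAR('k) dvd d" "is_ideal I" "\<And>i. pd i h \<in> I"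
  shows "h \<in> I"
proof -
  define u :: "('n, 'k) mpoly" where "u = single 0 (inverse (of_nat d))"
  have u: "u * of_nat d = 1" unfolding u_def by (rule mpoly_of_nat_inverse[OF assms(2)])
  have "of_nat d * h \<in> I"
    unfolding euler[OF assms(1), symmetric] using assms by (intro ideal_sum ideal_mult)
  then have "u * (of_nat d * h) \<in> I" by (rule ideal_mult[OF assms(3)])
  then show ?thesis using u by (metis mult.assoc mult_1)
qed

text \<open>By Euler's formula a prime that contains all partial derivatives also contains the form, so that
  smoothness rules out every homogeneous prime but the irrelevant one.\<close>

lemma smooth_form_jacobian:
  fixes h :: "('n::finite, 'k::field) mpoly"
  assumes "homogeneous d h" "\<not> CHAR('k) dvd d" "smooth_form h"
  shows "\<exists>N. order_ge N \<subseteq> jacobian_ideal h"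
proof (rule order_ge_subset_if_no_graded_primes[OF graded_jacobian[OF assms(1)]])
  fix P assume P: "prime_ideal P" "graded_ideal P" "jacobian_ideal h \<subseteq> P"
  then have "\<And>i. pd i h \<in> P" using pd_in_jacobian by blast
  moreover from this have "h \<in> P"
    using form_in_ideal_if_pd_in_ideal[OF assms(1,2)] P by (simp add: prime_ideal_ideal)
  ultimately show "max_ideal \<subseteq> P"
    using assms(3) P graded_ideal_homogeneous unfolding smooth_form_def by blast
qed

text \<open>Multiply \<open>(fg)\<^sub>i = f\<^sub>i g + f g\<^sub>i\<close> by \<open>g\<close>: the last term becomes a multiple of \<open>fg\<close>, which lies in the
  Jacobian ideal by Euler's formula.\<close>

lemma square_mult_pd_in_jacobian:
  fixes f g :: "('n::finite, 'k::field) mpoly"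
  assumes "homogeneous d f" "homogeneous e g" "\<not> CHAR('k) dvd (d + e)"
  shows "g ^ 2 * pd i f \<in> jacobian_ideal (f * g)"
proof -
  have "f * g \<in> jacobian_ideal (f * g)"
    using homogeneous_mult[OF assms(1,2)] assms(3)
    by (rule form_in_ideal_if_pd_in_ideal) (auto intro: pd_in_jacobian)
  then have "g * pd i (f * g) - pd i g * (f * g) \<in> jacobian_ideal (f * g)"
    by (intro ideal_diff ideal_mult[of _ "pd i (f * g)"] ideal_mult[of _ "f * g"] pd_in_jacobian) auto
  then show ?thesis by (simp add: pd_mult power2_eq_square algebra_simps)
qed

lemma square_in_saturation_jacobian:
  fixes f g :: "('n::finite, 'k::field) mpoly"
  assumes "homogeneous d f" "homogeneous e g"
    and "\<not> CHAR('k) dvd d" "\<not> CHAR('k) dvd (d + e)" "smooth_form f"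
  shows "g ^ 2 \<in> saturation max_ideal (jacobian_ideal (f * g))"
proof -
  let ?C = "{b. g ^ 2 * b \<in> jacobian_ideal (f * g)}"
  have "is_ideal ?C"
    by (rule is_idealI)
      (auto simp: ideal_zero distrib_left mult.left_commute intro: ideal_add ideal_mult)
  then have "jacobian_ideal f \<subseteq> ?C"
    using square_mult_pd_in_jacobian[OF assms(1,2,4)] by (intro jacobian_ideal_subset) auto
  moreover obtain N where "order_ge N \<subseteq> jacobian_ideal f"
    using smooth_form_jacobian[OF assms(1,3,5)] by blast
  ultimately have "ideal_power max_ideal N \<subseteq> ?C"
    using ideal_power_max_ideal_order_ge[of N] by blast
  then show ?thesis unfolding saturation_def colon_def by blast
qed

section \<open>Dimension of the polynomial ring\<close>

lemma underdetermined_system: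
  fixes M :: "'a \<Rightarrow> 'b \<Rightarrow> 'k::field"
  assumes "finite B" "finite A" "card B < card A"
  shows "\<exists>c. (\<exists>a\<in>A. c a \<noteq> 0) \<and> (\<forall>b\<in>B. (\<Sum>a\<in>A. c a * M a b) = 0)"
  using assms
proof (induction B arbitrary: A M)
  case empty
  then have "A \<noteq> {}" by auto
  then show ?case by (intro exI[of _ "\<lambda>_. 1"]) auto
next
  case (insert b B)
  show ?case
  proof (cases "\<forall>a\<in>A. M a b = 0")
    case True
    from insert.prems insert.hyps have "card B < card A" by simp
    from insert.IH[OF insert.prems(1) this, of M] True show ?thesis by auto
  next
    case False
    then obtain a0 where a0: "a0 \<in> A" "M a0 b \<noteq> 0" by blast
    let ?A = "A - {a0}" and ?M = "\<lambda>a b'. M a b' - M a b / M a0 b * M a0 b'"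
    have "card B < card ?A" using insert.prems insert.hyps a0 by simp
    from insert.IH[OF _ this, of ?M] insert.prems obtain c where
      c: "\<exists>a\<in>?A. c a \<noteq> 0" "\<And>b'. b' \<in> B \<Longrightarrow> (\<Sum>a\<in>?A. c a * ?M a b') = 0" by auto
    \<comment> \<open>The coefficient at \<open>a0\<close> is chosen to solve equation \<open>b\<close>.\<close>
    let ?c = "c(a0 := - (\<Sum>a\<in>?A. c a * (M a b / M a0 b)))"
    have split: "(\<Sum>a\<in>A. ?c a * M a b')
        = (\<Sum>a\<in>?A. c a * M a b') - (\<Sum>a\<in>?A. c a * (M a b / M a0 b)) * M a0 b'" for b'
    proof -
      have "(\<Sum>a\<in>A. ?c a * M a b') = ?c a0 * M a0 b' + (\<Sum>a\<in>?A. ?c a * M a b')"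
        using insert.prems a0 by (intro sum.remove) auto
      moreover have "(\<Sum>a\<in>?A. ?c a * M a b') = (\<Sum>a\<in>?A. c a * M a b')"
        by (intro sum.cong) auto
      ultimately show ?thesis by simp
    qed
    have "(\<Sum>a\<in>A. ?c a * M a b) = 0"
      unfolding split using a0 by (simp add: sum_distrib_right)
    moreover have "(\<Sum>a\<in>A. ?c a * M a b') = 0" if "b' \<in> B" for b'
      unfolding split using c(2)[OF that]
      by (simp add: sum_distrib_right right_diff_distrib sum_subtractf mult.assoc)
    moreover have "\<exists>a\<in>A. ?c a \<noteq> 0" using c(1) by auto
    ultimately show ?thesis by (intro exI[of _ ?c]) auto
  qed
qed

lemma lookup_const_mult: "lookup (single 0 c * p) m = c * lookup (p :: ('n, 'k::comm_ring_1) mpoly) m"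
  using lookup_single_mult_add[of 0 c p m] by simp

lemma prime_ideal_const: 
  fixes P :: "('n, 'k::field) mpoly set"
  assumes "prime_ideal P" "single 0 c \<in> P" shows "c = 0"
proof (rule ccontr)
  assume "c \<noteq> 0"
  then have "single 0 (inverse c) * single 0 c = (1 :: ('n, 'k) mpoly)" by (simp add: mult_single)
  then show False
    using ideal_mult[OF prime_ideal_ideal[OF assms(1)] assms(2), of "single 0 (inverse c)"]
      prime_ideal_one[OF assms(1)] by simp
qed

text \<open>Elements picked from the successive differences of a chain of primes are algebraically
  independent: in a relation, divide by the lowest power of the first element that occurs; what
  remains lies in the next prime, where the first element vanishes.\<close>

lemma prime_chain_no_relation:
  fixes P :: "nat \<Rightarrow> ('n, 'k::field) mpoly set"
  assumes "\<And>i. i \<le> n \<Longrightarrow> prime_ideal (P i)"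
    and "\<And>i. i < n \<Longrightarrow> P i \<subseteq> P (Suc i) \<and> a i \<in> P (Suc i) \<and> a i \<notin> P i"
    and "finite L" "\<And>e. e \<in> L \<Longrightarrow> length e = n"
    and "(\<Sum>e\<in>L. single 0 (c e) * (\<Prod>i<n. a i ^ (e ! i))) \<in> P 0"
    and "e \<in> L"
  shows "c e = 0"
  using assms
proof (induction n arbitrary: P a L c e)
  case 0
  then have "L = {[]}" by fastforce
  with "0.prems" have "single 0 (c []) \<in> P 0" by simp
  with "0.prems"(1,4,6) show ?case using prime_ideal_const by fastforce
next
  case (Suc n)
  note prime = Suc.prems(1) and chain = Suc.prems(2)
  show ?case
  proof (rule ccontr)
    assume "c e \<noteq> 0"
    \<comment> \<open>\<open>k\<close> is the lowest exponent of \<open>a 0\<close> in the relation.\<close>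
    let ?nz = "\<lambda>k. \<exists>e\<in>L. c e \<noteq> 0 \<and> e ! 0 = k"
    have "\<exists>k. ?nz k" using \<open>c e \<noteq> 0\<close> Suc.prems(6) by blast
    then obtain k where k: "?nz k" and min: "\<And>j. j < k \<Longrightarrow> \<not> ?nz j"
      using exists_least_iff[of ?nz] by blast
    let ?T = "\<lambda>e. single 0 (c e) * (\<Prod>i<n. a (Suc i) ^ (e ! Suc i))"
    let ?S = "\<Sum>e\<in>L. if c e = 0 then 0 else a 0 ^ (e ! 0 - k) * ?T e"
    have "(\<Sum>e\<in>L. single 0 (c e) * (\<Prod>i<Suc n. a i ^ (e ! i))) = a 0 ^ k * ?S"
      unfolding sum_distrib_left
    proof (rule sum.cong)
      fix e assume e: "e \<in> L"
      show "single 0 (c e) * (\<Prod>i<Suc n. a i ^ (e ! i))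
          = a 0 ^ k * (if c e = 0 then 0 else a 0 ^ (e ! 0 - k) * ?T e)"
      proof (cases "c e = 0")
        case False
        then have "k \<le> e ! 0" using min e by (metis not_le)
        then have "a 0 ^ (e ! 0) = a 0 ^ k * a 0 ^ (e ! 0 - k)" by (simp flip: power_add)
        then show ?thesis using False
          by (simp add: prod.lessThan_Suc_shift mult_ac del: prod.lessThan_Suc)
      qed simp
    qed simp
    with Suc.prems(5) have "a 0 ^ k * ?S \<in> P 0" by metis
    moreover have "a 0 ^ k \<notin> P 0" using prime_ideal_powerD[OF prime[of 0]] chain[of 0] by blast
    ultimately have "?S \<in> P 0" using prime_idealD[OF prime[of 0]] by blast
    then have S: "?S \<in> P (Suc 0)" using chain[of 0] by auto
    have I: "is_ideal (P (Suc 0))" using prime[of "Suc 0"] by (simp add: prime_ideal_ideal)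
    let ?L = "{e\<in>L. e ! 0 = k}"
    have "?S = (\<Sum>e\<in>L. (if e ! 0 = k then ?T e else 0)
        + (if c e = 0 \<or> e ! 0 = k then 0 else a 0 ^ (e ! 0 - k) * ?T e))"
      by (intro sum.cong) auto
    also have "\<dots> = (\<Sum>e\<in>?L. ?T e)
        + (\<Sum>e\<in>L. if c e = 0 \<or> e ! 0 = k then 0 else a 0 ^ (e ! 0 - k) * ?T e)"
      using Suc.prems(3) by (simp add: sum.distrib sum.inter_filter)
    finally have "(\<Sum>e\<in>?L. ?T e)
        + (\<Sum>e\<in>L. if c e = 0 \<or> e ! 0 = k then 0 else a 0 ^ (e ! 0 - k) * ?T e) \<in> P (Suc 0)"
      using S by simp
    moreover have "(if c e = 0 \<or> e ! 0 = k then 0 else a 0 ^ (e ! 0 - k) * ?T e) \<in> P (Suc 0)"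
      if e: "e \<in> L" for e
    proof (cases "c e = 0 \<or> e ! 0 = k")
      case True
      then show ?thesis using ideal_zero I by auto
    next
      case False
      then have "\<not> e ! 0 < k" "e ! 0 \<noteq> k" using min e by blast+
      then have "a 0 ^ (e ! 0 - k) = a 0 ^ (e ! 0 - k - 1) * a 0" using power_minus_mult[of "e ! 0 - k" "a 0"] by simp
      moreover have "a 0 \<in> P (Suc 0)" using chain[of 0] by simp
      ultimately have "a 0 ^ (e ! 0 - k) \<in> P (Suc 0)" by (simp only: ideal_mult[OF I])
      then show ?thesis using False by (auto intro: ideal_mult_right[OF I])
    qed
    then have "(\<Sum>e\<in>L. if c e = 0 \<or> e ! 0 = k then 0 else a 0 ^ (e ! 0 - k) * ?T e) \<in> P (Suc 0)"
      by (intro ideal_sum[OF I])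
    ultimately have T: "(\<Sum>e\<in>?L. ?T e) \<in> P (Suc 0)" using ideal_add_cancel[OF I] by blast
    have L: "e = k # tl e" if "e \<in> ?L" for e
      using that Suc.prems(4)[of e] by (cases e) auto
    have inj: "inj_on tl ?L"
    proof (rule inj_onI)
      fix x y assume x: "x \<in> ?L" and y: "y \<in> ?L" and "tl x = tl y"
      then show "x = y" using L[OF x, symmetric] L[OF y, symmetric] by argo
    qed
    have "(\<Sum>e\<in>tl ` ?L. single 0 (c (k # e)) * (\<Prod>i<n. a (Suc i) ^ (e ! i))) = (\<Sum>e\<in>?L. ?T e)"
      unfolding sum.reindex[OF inj] o_def
    proof (rule sum.cong)
      fix e assume "e \<in> ?L"
      from L[OF this] obtain e' where "e = k # e'" ..
      then show "single 0 (c (k # tl e)) * (\<Prod>i<n. a (Suc i) ^ (tl e ! i)) = ?T e" by simp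
    qed simp
    with T have T': "(\<Sum>e\<in>tl ` ?L. single 0 (c (k # e)) * (\<Prod>i<n. a (Suc i) ^ (e ! i))) \<in> P (Suc 0)"
      by simp
    obtain e' where e': "e' \<in> ?L" "c e' \<noteq> 0" using k by blast
    have "c (k # tl e') = 0"
    proof (rule Suc.IH[of "\<lambda>i. P (Suc i)" "\<lambda>i. a (Suc i)" "tl ` ?L" "\<lambda>e. c (k # e)"])
      show "finite (tl ` ?L)" using Suc.prems(3) by simp
    qed (use Suc.prems(4) prime chain T' e' in auto)
    moreover have "k # tl e' = e'" using L[OF e'(1)] by (rule sym)
    ultimately show False using e'(2) by simp
  qed
qed

text \<open>Bounding each exponent, and not the total degree, gives spaces whose dimension \<open>(T + 1)^n\<close> is
  immediate.\<close>

definition exponents_le :: "nat \<Rightarrow> ('n, 'k::comm_ring_1) mpoly set" where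
  "exponents_le T = {p. \<forall>m\<in>keys p. \<forall>j. lookup m j \<le> T}"

lemma exponents_le_mult:
  assumes "p \<in> exponents_le S" "q \<in> exponents_le T" shows "p * q \<in> exponents_le (S + T)"
  using assms keys_mult[of p q] by (fastforce simp: exponents_le_def lookup_add intro: add_mono)

lemma exponents_le_one: "1 \<in> exponents_le 0"
  by (simp add: exponents_le_def)

lemma exponents_le_mono: "S \<le> T \<Longrightarrow> exponents_le S \<subseteq> exponents_le T"
  by (auto simp: exponents_le_def intro: order_trans)

lemma exponents_le_power: "p \<in> exponents_le T \<Longrightarrow> p ^ k \<in> exponents_le (k * T)"
  by (induction k) (auto intro: exponents_le_mult exponents_le_one)

lemma exponents_le_prod:
  "(\<And>i. i < n \<Longrightarrow> p i \<in> exponents_le T) \<Longrightarrow> (\<Prod>i<n::nat. p i) \<in> exponents_le (n * T)"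
proof (induction n)
  case (Suc n)
  then have "(\<Prod>i<n. p i) * p n \<in> exponents_le (n * T + T)" by (intro exponents_le_mult) auto
  then show ?case by (simp add: add.commute)
qed (simp add: exponents_le_one)

lemma lookup_le_mdeg: "lookup m j \<le> mdeg m"
  unfolding mdeg_def by (rule member_le_sum) auto

lemma exponents_le_bound:
  fixes p :: "nat \<Rightarrow> ('n::finite, 'k::comm_ring_1) mpoly"
  shows "\<exists>D. \<forall>i<n. p i \<in> exponents_le D"
proof (induction n)
  case (Suc n)
  then obtain D where D: "\<forall>i<n. p i \<in> exponents_le D" ..
  let ?E = "Max (insert 0 (mdeg ` keys (p n)))"
  have "lookup m j \<le> ?E" if "m \<in> keys (p n)" for m j
  proof -
    have "lookup m j \<le> mdeg m" by (rule lookup_le_mdeg)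
    also have "\<dots> \<le> ?E" using that by (intro Max_ge) auto
    finally show ?thesis .
  qed
  then have "p n \<in> exponents_le ?E" by (auto simp: exponents_le_def)
  then have "\<forall>i<Suc n. p i \<in> exponents_le (max D ?E)"
    using D exponents_le_mono[of D "max D ?E"] exponents_le_mono[of ?E "max D ?E"]
    by (auto simp: less_Suc_eq)
  then show ?case ..
qed simp

lemma bounded_exponents:
  fixes T :: nat
  defines "B \<equiv> {m :: 'n::finite \<Rightarrow>\<^sub>0 nat. \<forall>j. lookup m j \<le> T}"
  shows "finite B" "card B \<le> Suc T ^ CARD('n)"
proof -
  let ?F = "PiE (UNIV :: 'n set) (\<lambda>_. {..T})"
  have fin: "finite ?F" by (intro finite_PiE) auto
  have inj: "inj_on lookup B" by (rule inj_onI, rule poly_mapping_eqI) simp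
  have sub: "lookup ` B \<subseteq> ?F" by (auto simp: B_def)
  from finite_subset[OF sub fin] inj show "finite B" by (simp add: finite_image_iff)
  have "card B = card (lookup ` B)" using inj by (simp add: card_image)
  also have "\<dots> \<le> card ?F" using fin sub by (rule card_mono)
  also have "\<dots> = Suc T ^ CARD('n)" by (simp add: card_PiE)
  finally show "card B \<le> Suc T ^ CARD('n)" .
qed

lemma finite_mdeg_le: "finite {m :: 'n::finite \<Rightarrow>\<^sub>0 nat. mdeg m \<le> N}"
proof (rule finite_subset)
  show "{m :: 'n \<Rightarrow>\<^sub>0 nat. mdeg m \<le> N} \<subseteq> {m. \<forall>j. lookup m j \<le> N}"
    using order_trans[OF lookup_le_mdeg] by blast
qed (rule bounded_exponents)

text \<open>There are \<open>s ^ (n + 1)\<close> power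
  products with exponents below \<open>s\<close>, in a space of dimension \<open>O(s ^ n)\<close>.\<close>

lemma algebraically_dependent:
  fixes a :: "nat \<Rightarrow> ('n::finite, 'k::field) mpoly"
  defines "n \<equiv> CARD('n)"
  obtains L c where "finite L" "\<And>e. e \<in> L \<Longrightarrow> length e = Suc n" "\<exists>e\<in>L. c e \<noteq> 0"
    "(\<Sum>e\<in>L. single 0 (c e) * (\<Prod>i<Suc n. a i ^ (e ! i))) = 0"
proof -
  obtain D where D: "\<And>i. i < Suc n \<Longrightarrow> a i \<in> exponents_le D"
    using exponents_le_bound[of "Suc n" a] by blast
  \<comment> \<open>The power products have exponents at most \<open>T\<close>, and \<open>s\<close> is chosen such that
    \<open>(T + 1)^n \<le> (s E)^n < s^(n + 1)\<close>.\<close>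
  define E where "E = Suc n * D + 1"
  define s where "s = E ^ n + 1"
  define T where "T = Suc n * (s * D)"
  define L where "L = {e. set e \<subseteq> {..<s} \<and> length e = Suc n}"
  define B where "B = {m :: 'n \<Rightarrow>\<^sub>0 nat. \<forall>j. lookup m j \<le> T}"
  have L: "finite L" "card L = s ^ Suc n"
    unfolding L_def using finite_lists_length_eq[of "{..<s}" "Suc n"] card_lists_length_eq[of "{..<s}" "Suc n"]
    by simp_all
  have B: "finite B" "card B \<le> Suc T ^ n"
    unfolding B_def n_def by (rule bounded_exponents)+
  have "Suc T \<le> s * E" by (simp add: T_def E_def s_def algebra_simps)
  then have "Suc T ^ n \<le> (s * E) ^ n" by (rule power_mono) simp
  also have "\<dots> = s ^ n * E ^ n" by (rule power_mult_distrib)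
  also have "\<dots> < s ^ n * s" by (simp add: s_def)
  finally have "card B < card L" using L B by (simp add: mult.commute)
  let ?p = "\<lambda>e. \<Prod>i<Suc n. a i ^ (e ! i)"
  obtain c where c: "\<exists>e\<in>L. c e \<noteq> 0" "\<And>m. m \<in> B \<Longrightarrow> (\<Sum>e\<in>L. c e * lookup (?p e) m) = 0"
    using underdetermined_system[OF B(1) L(1) \<open>card B < card L\<close>, of "\<lambda>e m. lookup (?p e) m"] by blast
  have p: "?p e \<in> exponents_le T" if "e \<in> L" for e
    unfolding T_def
  proof (rule exponents_le_prod)
    fix i assume i: "i < Suc n"
    then have "e ! i \<in> set e" using that by (intro nth_mem) (simp add: L_def)
    then have "e ! i < s" using that by (auto simp: L_def)
    then show "a i ^ (e ! i) \<in> exponents_le (s * D)"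
      using exponents_le_power[OF D[OF i], of "e ! i"] exponents_le_mono[of "e ! i * D" "s * D"]
      by (auto intro: mult_right_mono)
  qed
  have "(\<Sum>e\<in>L. single 0 (c e) * ?p e) = 0"
  proof (rule poly_mapping_eqI)
    fix m
    have "(\<Sum>e\<in>L. c e * lookup (?p e) m) = 0"
    proof (cases "m \<in> B")
      case False
      then have "lookup (?p e) m = 0" if "e \<in> L" for e
        using p[OF that] by (auto simp: B_def exponents_le_def in_keys_iff)
      then show ?thesis by (intro sum.neutral) (auto simp del: prod.lessThan_Suc)
    qed (rule c)
    then show "lookup (\<Sum>e\<in>L. single 0 (c e) * ?p e) m = lookup 0 m"
      by (simp add: lookup_sum lookup_const_mult del: prod.lessThan_Suc)
  qed
  with L(1) c(1) show thesis by (intro that[of L c]) (auto simp: L_def)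
qed

text \<open>In a longer chain, a relation between elements picked from the differences would contradict their
  independence.\<close>

lemma prime_chain_length:
  fixes P :: "nat \<Rightarrow> ('n::finite, 'k::field) mpoly set"
  assumes prime: "\<And>i. i \<le> r \<Longrightarrow> prime_ideal (P i)" and chain: "\<And>i. i < r \<Longrightarrow> P i \<subset> P (Suc i)"
  shows "r \<le> CARD('n)"
proof (rule ccontr)
  let ?n = "Suc CARD('n)"
  assume "\<not> ?thesis"
  then have r: "?n \<le> r" by simp
  have chain': "P i \<subset> P (Suc i)" if "i < ?n" for i
    by (rule chain) (rule less_le_trans[OF that r])
  define a where "a i = (SOME x. x \<in> P (Suc i) - P i)" for i
  have a: "a i \<in> P (Suc i) - P i" if "i < ?n" for i
    unfolding a_def using psubset_imp_ex_mem[OF chain'[OF that]] by (rule someI_ex)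
  obtain L and c :: "nat list \<Rightarrow> 'k" where L: "finite L" "\<And>e. e \<in> L \<Longrightarrow> length e = ?n" "\<exists>e\<in>L. c e \<noteq> 0"
    "(\<Sum>e\<in>L. single 0 (c e) * (\<Prod>i<?n. a i ^ (e ! i))) = 0"
    by (rule algebraically_dependent[of a]) blast
  have "c e = 0" if "e \<in> L" for e
  proof (rule prime_chain_no_relation[of ?n P a L c])
    show "prime_ideal (P i)" if "i \<le> ?n" for i
      by (rule prime) (rule order_trans[OF that r])
    show "P i \<subseteq> P (Suc i) \<and> a i \<in> P (Suc i) \<and> a i \<notin> P i" if "i < ?n" for i
      using chain'[OF that] a[OF that] by blast
    show "(\<Sum>e\<in>L. single 0 (c e) * (\<Prod>i<?n. a i ^ (e ! i))) \<in> P 0"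
      unfolding L(4) using prime[of 0] by (simp add: ideal_zero prime_ideal_ideal)
  qed (use L that in auto)
  with L(3) show False by blast
qed

section \<open>Homogeneous primes of closed points\<close>

text \<open>The usual argument that a prime ideal extends to a prime ideal of the polynomial ring: compare the
  coefficients of \<open>u\<close> and \<open>s\<close> of lowest index outside \<open>I\<close>. Primality of \<open>I\<close> enters only for elements
  of a set \<open>B\<close> that contains all coefficients; for Gauss's lemma below \<open>B\<close> is a subring.\<close>

lemma coeffs_prime:
  fixes u s :: "'a::comm_ring_1 poly"
  assumes I: "is_ideal I" and prime: "\<And>a b. a \<in> B \<Longrightarrow> b \<in> B \<Longrightarrow> a * b \<in> I \<Longrightarrow> a \<in> I \<or> b \<in> I"
    and u: "\<And>k. coeff u k \<in> B" and s: "\<And>k. coeff s k \<in> B"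
    and us: "\<And>k. coeff (u * s) k \<in> I"
  shows "(\<forall>k. coeff u k \<in> I) \<or> (\<forall>k. coeff s k \<in> I)"
proof (rule ccontr)
  assume "\<not> ?thesis"
  then obtain j k where j: "coeff u j \<notin> I" "\<And>i. i < j \<Longrightarrow> coeff u i \<in> I"
    and k: "coeff s k \<notin> I" "\<And>i. i < k \<Longrightarrow> coeff s i \<in> I"
    using exists_least_iff[of "\<lambda>k. coeff u k \<notin> I"] exists_least_iff[of "\<lambda>k. coeff s k \<notin> I"] by blast
  have "coeff u i * coeff s (j + k - i) \<in> I" if "i \<in> {..j + k} - {j}" for i
  proof (cases "i < j")
    case True
    then show ?thesis using j(2) by (intro ideal_mult_right[OF I]) auto
  next
    case False
    with that have "j + k - i < k" by auto
    then show ?thesis using k(2) by (intro ideal_mult[OF I]) auto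
  qed
  then have "(\<Sum>i\<in>{..j + k} - {j}. coeff u i * coeff s (j + k - i)) \<in> I"
    by (intro ideal_sum[OF I])
  moreover have "coeff (u * s) (j + k) = coeff u j * coeff s k
      + (\<Sum>i\<in>{..j + k} - {j}. coeff u i * coeff s (j + k - i))"
    unfolding coeff_mult by (subst sum.remove[of _ j]) auto
  ultimately have "coeff u j * coeff s k \<in> I" using us[of "j + k"] by (simp add: ideal_add_cancel[OF I])
  then show False using prime u s j k by blast
qed

text \<open>The extension of the contraction of \<open>Q\<close> to the subring of polynomials without \<open>x\<^sub>i\<close>.\<close>

definition extend_contraction :: "'n \<Rightarrow> ('n, 'k::comm_ring_1) mpoly set \<Rightarrow> ('n, 'k) mpoly set" where
  "extend_contraction i Q = {p. \<forall>k. coeff (upoly i p) k \<in> Q}"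

lemma extend_contraction_subset:
  assumes "is_ideal Q" shows "extend_contraction i Q \<subseteq> Q"
proof
  fix p assume "p \<in> extend_contraction i Q"
  then have "poly (upoly i p) (mvar i) \<in> Q"
    unfolding poly_altdef extend_contraction_def
    by (intro ideal_sum ideal_mult_right assms) auto
  then show "p \<in> Q" by (simp add: poly_upoly)
qed

lemma prime_extend_contraction:
  assumes Q: "prime_ideal Q" shows "prime_ideal (extend_contraction i Q)"
proof -
  note I = prime_ideal_ideal[OF Q]
  have "is_ideal (extend_contraction i Q)"
  proof (rule is_idealI)
    fix c x assume "x \<in> extend_contraction i Q"
    then show "c * x \<in> extend_contraction i Q"
      by (auto simp: extend_contraction_def upoly_mult coeff_mult intro!: ideal_sum[OF I] ideal_mult[OF I])
  qed (auto simp: extend_contraction_def upoly_add intro: ideal_zero[OF I] ideal_add[OF I])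
  moreover have "1 \<notin> extend_contraction i Q"
    using extend_contraction_subset[OF I] prime_ideal_one[OF Q] by blast
  moreover have "a \<in> extend_contraction i Q \<or> b \<in> extend_contraction i Q"
    if "a * b \<in> extend_contraction i Q" for a b
    using coeffs_prime[OF I, of UNIV "upoly i a" "upoly i b"] prime_idealD[OF Q] that
    by (auto simp: extend_contraction_def upoly_mult)
  ultimately show ?thesis by (simp add: prime_ideal_def)
qed

lemma in_extend_contractions:
  assumes "h \<in> polys_in V" "set is \<inter> V = {}" "h \<in> Q" "is_ideal Q"
  shows "h \<in> foldr extend_contraction is Q"
  using assms(2)
proof (induction "is")
  case (Cons i "is")
  then have "upoly i h = [:h:]" "h \<in> foldr extend_contraction is Q"
    using upoly_polys_in[OF assms(1)] by auto
  moreover have "0 \<in> foldr extend_contraction is Q"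
    using assms(4) by (induction "is") (auto simp: extend_contraction_def ideal_zero)
  ultimately have "coeff (upoly i h) k \<in> foldr extend_contraction is Q" for k
    by (auto simp: coeff_pCons split: nat.split)
  then show ?case by (simp add: extend_contraction_def[of i "foldr extend_contraction is Q"])
qed (use assms in simp)

lemma prime_extend_contractions: "prime_ideal Q \<Longrightarrow> prime_ideal (foldr extend_contraction is Q)"
  by (induction "is") (auto intro: prime_extend_contraction)

lemma extend_contractions_subset:
  assumes "prime_ideal Q" shows "foldr extend_contraction is Q \<subseteq> Q"
proof (induction "is")
  case (Cons i "is")
  then show ?case
    using extend_contraction_subset[OF prime_ideal_ideal[OF prime_extend_contractions[OF assms]], of i "is"]
    by auto
qed simp

text \<open>A homogeneous prime \<open>Q\<close> that becomes irrelevant after adding one variable \<open>x\<^sub>v\<close> outside \<open>Q\<close>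
  corresponds to a closed point of projective space. To find such a \<open>Q\<close> above \<open>P\<close>, take a smallest set
  \<open>V\<close> of variables without common zero on the projective zero set of \<open>P\<close>; all members of \<open>V\<close> but one,
  \<open>x\<^sub>v\<close>, still have a common zero there. The exponent is written as a successor because
  positivity is needed below.\<close>

lemma graded_prime_of_point:
  fixes P :: "('n::finite, 'k::field) mpoly set"
  assumes P: "prime_ideal P" "graded_ideal P" "\<not> max_ideal \<subseteq> P"
  obtains Q v N where "prime_ideal Q" "graded_ideal Q" "P \<subseteq> Q" "mvar v \<notin> Q"
    "order_ge (Suc N) \<subseteq> ideal_gen (insert (mvar v) Q)"
proof -
  let ?J = "\<lambda>V :: 'n set. ideal_gen (P \<union> mvar ` V)"
  let ?irr = "\<lambda>V. \<exists>N. order_ge N \<subseteq> ?J V"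
  have no_order_ge: "\<not> order_ge N \<subseteq> R" if R: "prime_ideal R" "\<not> max_ideal \<subseteq> R"
    for N and R :: "('n, 'k) mpoly set"
  proof
    assume *: "order_ge N \<subseteq> R"
    have "mvar i \<in> R" for i
    proof (rule prime_ideal_powerD[OF R(1)])
      have "(mvar i :: ('n, 'k) mpoly) ^ N \<in> order_ge N" by (simp add: order_ge_def mvar_power)
      then show "mvar i ^ N \<in> R" using * by blast
    qed
    then show False using max_ideal_subset[OF prime_ideal_ideal[OF R(1)]] R(2) by blast
  qed
  have "?irr UNIV"
    by (rule order_ge_subset_if_powers[OF is_ideal_gen])
      (auto intro!: exI[of _ 1] ideal_gen_base)
  then obtain V where V: "?irr V" and min: "\<And>V'. ?irr V' \<Longrightarrow> card V \<le> card V'"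
    using ex_has_least_nat[of ?irr UNIV card] by blast
  have "V \<noteq> {}"
    using V no_order_ge[OF P(1,3)] ideal_gen_eq[OF prime_ideal_ideal[OF P(1)]] by auto
  then obtain v where v: "v \<in> V" by blast
  have "\<not> ?irr (V - {v})" using min[of "V - {v}"] v by (metis card_Diff1_less finite not_le)
  moreover have "graded_ideal (?J (V - {v}))"
    by (rule graded_ideal_gen_extend[OF P(2)]) (auto intro: homogeneous_mvar)
  ultimately obtain Q where Q: "prime_ideal Q" "graded_ideal Q" "?J (V - {v}) \<subseteq> Q" "\<not> max_ideal \<subseteq> Q"
    using order_ge_subset_if_no_graded_primes by blast
  have PQ: "P \<union> mvar ` (V - {v}) \<subseteq> Q" using ideal_gen_superset Q(3) by (rule order_trans)
  then have "P \<union> mvar ` V \<subseteq> insert (mvar v) Q" by auto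
  also have "\<dots> \<subseteq> ideal_gen (insert (mvar v) Q)" by (rule ideal_gen_superset)
  finally have "?J V \<subseteq> ideal_gen (insert (mvar v) Q)" using is_ideal_gen by (rule ideal_gen_least)
  with V obtain N where N: "order_ge N \<subseteq> ideal_gen (insert (mvar v) Q)" by blast
  have "mvar v \<notin> Q"
  proof
    assume "mvar v \<in> Q"
    then have "ideal_gen (insert (mvar v) Q) = Q"
      using ideal_gen_eq[OF prime_ideal_ideal[OF Q(1)]] by (simp add: insert_absorb)
    then show False using N no_order_ge[OF Q(1,4)] by simp
  qed
  moreover have "order_ge (Suc N) \<subseteq> (order_ge N :: ('n, 'k) mpoly set)" by (auto simp: order_ge_def)
  ultimately show thesis using that[of Q v N] Q(1,2) PQ N by blast
qed

text \<open>The dimension of the forms of degree \<open>t\<close> modulo such a prime stays bounded: a form of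
  degree above \<open>N\<close> is modulo \<open>Q\<close> a multiple of \<open>x\<^sub>v\<close>.\<close>

lemma forms_spanned_mod:
  fixes Q :: "('n::finite, 'k::field) mpoly set"
  assumes Q: "prime_ideal Q" "graded_ideal Q"
    and N: "order_ge (Suc N) \<subseteq> ideal_gen (insert (mvar v) Q)"
    and p: "homogeneous t p"
  shows "\<exists>A. p - (\<Sum>\<mu>\<in>{\<mu>. mdeg \<mu> \<le> N}. single 0 (A \<mu>) * (mvar v ^ (t - mdeg \<mu>) * single \<mu> 1)) \<in> Q"
  using p
proof (induction t arbitrary: p rule: less_induct)
  case (less t)
  note I = prime_ideal_ideal[OF Q(1)]
  let ?B = "{\<mu> :: 'n \<Rightarrow>\<^sub>0 nat. mdeg \<mu> \<le> N}"
  have fin: "finite ?B" by (rule finite_mdeg_le)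
  show ?case
  proof (cases "t \<le> N")
    case True
    then have "keys p \<subseteq> ?B" using less.prems by (auto simp: homogeneous_def)
    with fin have "p = (\<Sum>\<mu>\<in>?B. single \<mu> (lookup p \<mu>))" by (rule mpoly_expand)
    also have "\<dots> = (\<Sum>\<mu>\<in>?B. single 0 (lookup p \<mu>) * (mvar v ^ (t - mdeg \<mu>) * single \<mu> 1))"
    proof (rule sum.cong)
      fix \<mu>
      show "single \<mu> (lookup p \<mu>)
          = single 0 (lookup p \<mu>) * (mvar v ^ (t - mdeg \<mu>) * single \<mu> 1)"
      proof (cases "\<mu> \<in> keys p")
        case True
        then have "mdeg \<mu> = t" using less.prems by (simp add: homogeneous_def)
        then show ?thesis by (simp add: mult_single)
      qed (simp add: in_keys_iff)
    qed simp
    finally have "p - (\<Sum>\<mu>\<in>?B. single 0 (lookup p \<mu>) * (mvar v ^ (t - mdeg \<mu>) * single \<mu> 1)) = 0"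
      by simp
    then have "p - (\<Sum>\<mu>\<in>?B. single 0 (lookup p \<mu>) * (mvar v ^ (t - mdeg \<mu>) * single \<mu> 1)) \<in> Q"
      using ideal_zero[OF I] by (simp only:)
    then show ?thesis by blast
  next
    case False
    then have "p \<in> order_ge (Suc N)" using less.prems by (intro homogeneous_order_ge) auto
    then have "p \<in> ideal_gen (insert (mvar v) Q)" using N by (rule subsetD[rotated])
    then obtain q s where q: "q \<in> Q" and pqs: "p = q + s * mvar v" by (rule ideal_gen_insertE[OF I])
    have "hpoly p = hpoly q + monom (mvar v) 1 * hpoly s"
      unfolding pqs by (simp only: hpoly_add hpoly_mult hpoly_homogeneous[OF homogeneous_mvar] mult.commute)
    then have "hcomp t p = hcomp t q + hcomp t (mvar v * s)"
      by (simp only: hpoly_mult hpoly_homogeneous[OF homogeneous_mvar] coeff_add)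
    also have "hcomp t (mvar v * s) = mvar v * hcomp (t - 1) s"
      unfolding hpoly_mult hpoly_homogeneous[OF homogeneous_mvar] coeff_monom_mult using False by simp
    finally have pt: "p = hcomp t q + mvar v * hcomp (t - 1) s"
      unfolding hcomp_homogeneous[OF less.prems] by simp
    have "t - 1 < t" using False by simp
    from less.IH[OF this homogeneous_hcomp[of "t - 1" s]] obtain A where
      A: "hcomp (t - 1) s - (\<Sum>\<mu>\<in>?B. single 0 (A \<mu>) * (mvar v ^ (t - 1 - mdeg \<mu>) * single \<mu> 1)) \<in> Q"
      (is "_ - ?S \<in> Q") by blast
    have "mvar v * ?S = (\<Sum>\<mu>\<in>?B. single 0 (A \<mu>) * (mvar v ^ (t - mdeg \<mu>) * single \<mu> 1))"
      unfolding sum_distrib_left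
    proof (rule sum.cong)
      fix \<mu> assume "\<mu> \<in> ?B"
      then have "t - mdeg \<mu> = Suc (t - 1 - mdeg \<mu>)" using False by auto
      then show "mvar v * (single 0 (A \<mu>) * (mvar v ^ (t - 1 - mdeg \<mu>) * single \<mu> 1))
          = single 0 (A \<mu>) * (mvar v ^ (t - mdeg \<mu>) * single \<mu> 1)"
        by (simp only: power_Suc mult_ac)
    qed simp
    moreover have "hcomp t q + mvar v * (hcomp (t - 1) s - ?S) \<in> Q"
      by (intro ideal_add[OF I] ideal_mult[OF I] A graded_idealD[OF Q(2)] q)
    ultimately have "p - (\<Sum>\<mu>\<in>?B. single 0 (A \<mu>) * (mvar v ^ (t - mdeg \<mu>) * single \<mu> 1)) \<in> Q"
      unfolding pt by (simp add: right_diff_distrib add_diff_eq)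
    then show ?thesis by blast
  qed
qed

text \<open>Modulo \<open>Q\<close> every \<open>x\<^sub>i\<close> is algebraic over \<open>x\<^sub>v\<close>, as in large degree \<open>t\<close> there are more monomials
  \<open>x\<^sub>i^a x\<^sub>v^(t - a)\<close> than the dimension of the forms modulo \<open>Q\<close>.\<close>

lemma binary_form_in_prime:
  fixes Q :: "('n::finite, 'k::field) mpoly set"
  assumes Q: "prime_ideal Q" "graded_ideal Q"
    and N: "order_ge (Suc N) \<subseteq> ideal_gen (insert (mvar v) Q)"
  shows "\<exists>t c. (\<exists>a\<le>t. c a \<noteq> 0) \<and> (\<Sum>a\<le>t. single (single i a + single v (t - a)) (c a)) \<in> Q"
proof -
  note I = prime_ideal_ideal[OF Q(1)]
  let ?B = "{\<mu> :: 'n \<Rightarrow>\<^sub>0 nat. mdeg \<mu> \<le> N}"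
  have fin: "finite ?B" by (rule finite_mdeg_le)
  define t where "t = card ?B"
  let ?p = "\<lambda>a. single (single i a + single v (t - a)) (1::'k)"
  let ?b = "\<lambda>\<mu>. mvar v ^ (t - mdeg \<mu>) * single \<mu> (1::'k)"
  have "\<forall>a\<in>{..t}. \<exists>A. ?p a - (\<Sum>\<mu>\<in>?B. single 0 (A \<mu>) * ?b \<mu>) \<in> Q"
  proof
    fix a assume "a \<in> {..t}"
    then have "homogeneous t (?p a)" by (auto simp: homogeneous_def mdeg_add)
    then show "\<exists>A. ?p a - (\<Sum>\<mu>\<in>?B. single 0 (A \<mu>) * ?b \<mu>) \<in> Q"
      by (rule forms_spanned_mod[OF Q N])
  qed
  from bchoice[OF this] obtain A
    where A: "\<forall>a\<in>{..t}. ?p a - (\<Sum>\<mu>\<in>?B. single 0 (A a \<mu>) * ?b \<mu>) \<in> Q" ..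
  have "card ?B < card {..t}" by (simp add: t_def)
  from underdetermined_system[OF fin finite_atMost this, of A] obtain c where
    c: "\<exists>a\<in>{..t}. c a \<noteq> 0" "\<forall>\<mu>\<in>?B. (\<Sum>a\<le>t. c a * A a \<mu>) = 0" by (elim exE conjE)
  have "(\<Sum>a\<le>t. single 0 (c a) * (\<Sum>\<mu>\<in>?B. single 0 (A a \<mu>) * ?b \<mu>))
      = (\<Sum>\<mu>\<in>?B. single 0 (\<Sum>a\<le>t. c a * A a \<mu>) * ?b \<mu>)"
  proof -
    have "single 0 (\<Sum>a\<in>M. f a) = (\<Sum>a\<in>M. single (0 :: 'n \<Rightarrow>\<^sub>0 nat) (f a))" for M and f :: "nat \<Rightarrow> 'k"
      by (induction M rule: infinite_finite_induct) (auto simp: single_add)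
    then have "(\<Sum>\<mu>\<in>?B. single 0 (\<Sum>a\<le>t. c a * A a \<mu>) * ?b \<mu>)
        = (\<Sum>\<mu>\<in>?B. \<Sum>a\<le>t. single 0 (c a * A a \<mu>) * ?b \<mu>)"
      by (simp only: sum_distrib_right)
    also have "\<dots> = (\<Sum>a\<le>t. \<Sum>\<mu>\<in>?B. single 0 (c a * A a \<mu>) * ?b \<mu>)" by (rule sum.swap)
    also have "\<dots> = (\<Sum>a\<le>t. single 0 (c a) * (\<Sum>\<mu>\<in>?B. single 0 (A a \<mu>) * ?b \<mu>))"
      unfolding sum_distrib_left mult.assoc[symmetric] mult_single add_0 by (rule refl)
    finally show ?thesis by (rule sym)
  qed
  also have "\<dots> = 0" using c(2) by (intro sum.neutral) simp
  finally have zero: "(\<Sum>a\<le>t. single 0 (c a) * (\<Sum>\<mu>\<in>?B. single 0 (A a \<mu>) * ?b \<mu>)) = 0" .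
  have "(\<Sum>a\<le>t. single 0 (c a) * (?p a - (\<Sum>\<mu>\<in>?B. single 0 (A a \<mu>) * ?b \<mu>))) \<in> Q"
    using A by (intro ideal_sum[OF I] ideal_mult[OF I]) (rule bspec)
  then have "(\<Sum>a\<le>t. single 0 (c a) * ?p a) \<in> Q"
    by (simp add: right_diff_distrib sum_subtractf zero)
  then have "(\<Sum>a\<le>t. single (single i a + single v (t - a)) (c a)) \<in> Q"
    by (simp add: mult_single)
  with c(1) show ?thesis by (intro exI[of _ t] exI[of _ c]) auto
qed

lemma order_ge_1_iff: "p \<in> order_ge 1 \<longleftrightarrow> hcomp 0 p = 0"
proof
  assume "p \<in> order_ge 1"
  then have "0 \<notin> keys p" by (auto simp: order_ge_def)
  then have "lookup p 0 = 0" by (simp add: in_keys_iff)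
  then show "hcomp 0 p = 0" by (intro poly_mapping_eqI) (simp add: lookup_hcomp)
next
  assume "hcomp 0 p = 0"
  then have "lookup p 0 = 0" using lookup_hcomp[of p 0 0] by simp
  then have "m \<noteq> 0" if "m \<in> keys p" for m using that by (auto simp: in_keys_iff)
  then have "0 < mdeg m" if "m \<in> keys p" for m using that by (metis mdeg_eq_0_iff neq0_conv)
  then show "p \<in> order_ge 1" by (simp add: order_ge_def Suc_le_eq)
qed

lemma prime_order_ge_1: "prime_ideal (order_ge 1 :: ('n::{finite,linorder}, 'k::field) mpoly set)"
proof -
  have "(1 :: ('n, 'k) mpoly) \<notin> order_ge 1" by (simp add: order_ge_def)
  then show ?thesis
    unfolding prime_ideal_def using is_ideal_order_ge
    by (auto simp: order_ge_1_iff[unfolded One_nat_def] hpoly_mult coeff_mult)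
qed

lemma graded_prime_in_order_ge_1:
  fixes Q :: "('n::finite, 'k::field) mpoly set"
  assumes "prime_ideal Q" "graded_ideal Q" shows "Q \<subseteq> order_ge 1"
proof
  fix q assume "q \<in> Q"
  then have *: "hcomp 0 q \<in> Q" by (rule graded_idealD[OF assms(2)])
  have "hcomp 0 q = single 0 (lookup q 0)"
    by (rule poly_mapping_eqI) (auto simp: lookup_hcomp lookup_single "when_def")
  with * show "q \<in> order_ge 1"
    using prime_ideal_const[OF assms(1)] by (metis order_ge_1_iff single_zero)
qed

text \<open>The height of the prime of a closed point. A chain below \<open>Q\<close> is obtained by
  contracting \<open>Q\<close> to ever fewer variables and extending back; the steps are strict as
  every variable satisfies modulo \<open>Q\<close> an algebraic equation over \<open>x\<^sub>v\<close>. No chain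
  is longer, because it could be continued by the irrelevant ideal.\<close>

lemma height_of_point:
  fixes Q :: "('n::{finite,linorder}, 'k::field) mpoly set"
  assumes Q: "prime_ideal Q" "graded_ideal Q" "mvar v \<notin> Q"
    and N: "order_ge (Suc N) \<subseteq> ideal_gen (insert (mvar v) Q)"
  shows "height Q = enat (CARD('n) - 1)"
proof -
  note I = prime_ideal_ideal[OF Q(1)]
  let ?chain = "\<lambda>k C. (\<forall>i\<le>k. prime_ideal (C i)) \<and> (\<forall>i<k. C i \<subset> C (Suc i)) \<and> C k = Q"
  let ?n = "CARD('n) - 1"
  have upper: "k \<le> ?n" if "?chain k C" for k C
  proof -
    let ?C = "\<lambda>i. if i \<le> k then C i else order_ge 1"
    have "(mvar v :: ('n, 'k) mpoly) \<in> order_ge 1" using mvar_in_max_ideal max_ideal_order_ge by blast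
    then have "Q \<subset> order_ge 1" using Q(3) graded_prime_in_order_ge_1[OF Q(1,2)] by blast
    then have "Suc k \<le> CARD('n)"
      using that by (intro prime_chain_length[of "Suc k" ?C]) (auto simp: prime_order_ge_1[unfolded One_nat_def] le_Suc_eq less_Suc_eq)
    then show ?thesis by simp
  qed
  \<comment> \<open>\<open>C j\<close> is generated by the elements of \<open>Q\<close> in \<open>x\<^sub>v\<close> and the first \<open>j\<close> other variables.\<close>
  obtain vs where vs: "set vs = UNIV - {v}" "distinct vs" using finite_distinct_list[of "UNIV - {v}"] by auto
  then have len: "length vs = ?n" using distinct_card[of vs] by simp
  define C where "C j = foldr extend_contraction (drop j vs) Q" for j
  have prime: "prime_ideal (C j)" for j unfolding C_def by (rule prime_extend_contractions[OF Q(1)])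
  have step: "C j \<subset> C (Suc j)" if "j < ?n" for j
  proof -
    let ?i = "vs ! j"
    have Cj: "C j = extend_contraction ?i (C (Suc j))"
      using that len by (simp add: C_def flip: Cons_nth_drop_Suc)
    then have "C j \<subseteq> C (Suc j)" using extend_contraction_subset prime prime_ideal_ideal by metis
    moreover have "C j \<noteq> C (Suc j)"
    proof
      assume eq: "C j = C (Suc j)"
      \<comment> \<open>The equation for the next variable lies in \<open>C (Suc j)\<close>, but its coefficients are constant
        multiples of powers of \<open>x\<^sub>v\<close>, and the nonzero ones lie outside \<open>Q\<close>.\<close>
      obtain t c where tc: "\<exists>a\<le>t. c a \<noteq> 0" "(\<Sum>a\<le>t. single (single ?i a + single v (t - a)) (c a)) \<in> Q"
        (is "?h \<in> Q") using binary_form_in_prime[OF Q(1,2) N] by blast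
      have iv: "?i \<noteq> v" using vs that len by (metis Diff_iff insertI1 nth_mem)
      have "?h \<in> polys_in {?i, v}"
      proof -
        have "keys ?h \<subseteq> (\<Union>a\<in>{..t}. keys (single (single ?i a + single v (t - a)) (c a)))"
          by (rule keys_sum)
        moreover have "keys (single ?i a + single v b) \<subseteq> {?i, v}" for a b :: nat
          using keys_add[of "single ?i a" "single v b"] by (auto split: if_splits)
        ultimately show ?thesis by (fastforce simp: polys_in_def split: if_splits)
      qed
      moreover have "set (drop (Suc j) vs) \<inter> {?i, v} = {}"
      proof -
        have "?i \<notin> set (drop (Suc j) vs)"
          using vs(2) that len distinct_drop[of vs j] by (metis Cons_nth_drop_Suc distinct.simps(2))
        moreover have "v \<notin> set (drop (Suc j) vs)" using vs(1) set_drop_subset by fastforce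
        ultimately show ?thesis by blast
      qed
      ultimately have "?h \<in> C (Suc j)" unfolding C_def using tc(2) I by (rule in_extend_contractions)
      moreover have "C (Suc j) \<subseteq> extend_contraction ?i (C (Suc j))" using eq Cj by (rule eq_refl[OF trans[OF sym]])
      ultimately have "?h \<in> extend_contraction ?i (C (Suc j))" by (rule subsetD[rotated])
      then have coeffs: "coeff (upoly ?i ?h) a \<in> C (Suc j)" for a
        by (simp add: extend_contraction_def)
      have "upoly ?i ?h = (\<Sum>a\<le>t. monom (single (single v (t - a)) (c a)) a)"
        unfolding upoly_sum upoly_single using iv by (simp add: lookup_add lookup_single)
      then have coeff_h: "coeff (upoly ?i ?h) a = (if a \<le> t then single (single v (t - a)) (c a) else 0)" for a
        by (simp add: coeff_sum)
      have "c a = 0" if "a \<le> t" for a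
      proof -
        have "single (single v (t - a)) (c a) \<in> Q"
          using coeffs[of a] that extend_contractions_subset[OF Q(1), of "drop (Suc j) vs"]
          unfolding coeff_h C_def by auto
        then have "single 0 (c a) * mvar v ^ (t - a) \<in> Q" by (simp add: mvar_power mult_single)
        then have "single 0 (c a) \<in> Q"
          using prime_idealD[OF Q(1)] prime_ideal_powerD[OF Q(1)] Q(3) by blast
        then show ?thesis by (rule prime_ideal_const[OF Q(1)])
      qed
      with tc(1) show False by blast
    qed
    ultimately show ?thesis by blast
  qed
  have "C ?n = Q" using len by (simp add: C_def)
  with prime step have "?chain ?n C" by blast
  then have "enat ?n \<le> height Q" unfolding height_def by (intro Sup_upper) blast
  moreover have "height Q \<le> enat ?n" unfolding height_def using upper by (intro Sup_least) auto
  ultimately show ?thesis by (rule antisym[rotated])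
qed

section \<open>Koszul homology\<close>

text \<open>Koszul chains are alternating functions on lists of indices; the value at a list of length
  \<open>p\<close> is the coefficient of the corresponding wedge product of \<open>p\<close> basis vectors. On lists
  the boundary map needs no signs.\<close>

definition alternating :: "('n list \<Rightarrow> 'a::comm_ring_1) \<Rightarrow> bool" where
  "alternating \<omega> \<longleftrightarrow> (\<forall>xs i j ys. \<omega> (xs @ i # j # ys) = - \<omega> (xs @ j # i # ys))
    \<and> (\<forall>xs i ys. \<omega> (xs @ i # i # ys) = 0)"

definition kboundary :: "('n::finite \<Rightarrow> 'a::comm_ring_1) \<Rightarrow> ('n list \<Rightarrow> 'a) \<Rightarrow> 'n list \<Rightarrow> 'a" where
  "kboundary h \<omega> is = (\<Sum>i\<in>UNIV. h i * \<omega> (i # is))"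

fun wedge :: "('n \<Rightarrow> 'a::comm_ring_1) \<Rightarrow> ('n list \<Rightarrow> 'a) \<Rightarrow> 'n list \<Rightarrow> 'a" where
  "wedge b \<omega> [] = 0"
| "wedge b \<omega> (i # is) = b i * \<omega> is - wedge b (\<lambda>js. \<omega> (i # js)) is"

lemma alternatingI:
  "(\<And>xs i j ys. \<omega> (xs @ i # j # ys) = - \<omega> (xs @ j # i # ys)) \<Longrightarrow>
   (\<And>xs i ys. \<omega> (xs @ i # i # ys) = 0) \<Longrightarrow> alternating \<omega>"
  unfolding alternating_def by blast

lemma alternating_swap: "alternating \<omega> \<Longrightarrow> \<omega> (xs @ i # j # ys) = - \<omega> (xs @ j # i # ys)"
  and alternating_repeat: "alternating \<omega> \<Longrightarrow> \<omega> (xs @ i # i # ys) = 0"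
  unfolding alternating_def by blast+

lemma alternating_Cons:
  assumes "alternating \<omega>" shows "alternating (\<lambda>js. \<omega> (i # js))"
proof (rule alternatingI)
  show "\<omega> (i # xs @ j # k # ys) = - \<omega> (i # xs @ k # j # ys)" for xs j k ys
    using alternating_swap[OF assms, of "i # xs" j k ys] by simp
  show "\<omega> (i # xs @ j # j # ys) = 0" for xs j ys
    using alternating_repeat[OF assms, of "i # xs"] by simp
qed

text \<open>Successive swaps bring two equal entries next to each other.\<close>

lemma alternating_eq_0:
  assumes "alternating \<omega>" "\<not> distinct is" shows "\<omega> is = 0"
proof -
  have "\<omega> (xs @ y # ys @ y # zs) = 0" for xs y ys zs
  proof (induction ys arbitrary: xs)
    case (Cons k ys)
    have "\<omega> (xs @ y # k # ys @ y # zs) = - \<omega> ((xs @ [k]) @ y # ys @ y # zs)"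
      using alternating_swap[OF assms(1), of xs y k "ys @ y # zs"] by simp
    then show ?case using Cons[of "xs @ [k]"] by simp
  qed (simp add: alternating_repeat[OF assms(1)])
  moreover obtain xs y ys zs where "is = xs @ [y] @ ys @ [y] @ zs"
    using not_distinct_decomp[OF assms(2)] by blast
  ultimately show ?thesis by simp
qed

lemma alternating_diff:
  assumes "alternating \<omega>" "alternating \<eta>" shows "alternating (\<lambda>is. \<omega> is - \<eta> is)"
proof (rule alternatingI)
  show "\<omega> (xs @ i # j # ys) - \<eta> (xs @ i # j # ys) = - (\<omega> (xs @ j # i # ys) - \<eta> (xs @ j # i # ys))"
    for xs i j ys
    using alternating_swap[OF assms(1), of xs i j ys] alternating_swap[OF assms(2), of xs i j ys] by simp
  show "\<omega> (xs @ i # i # ys) - \<eta> (xs @ i # i # ys) = 0" for xs i ys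
    using alternating_repeat[OF assms(1)] alternating_repeat[OF assms(2)] by simp
qed

lemma alternating_kboundary:
  assumes "alternating \<omega>" shows "alternating (kboundary h \<omega>)"
proof (rule alternatingI)
  fix xs i j ys
  have "\<omega> (k # xs @ i # j # ys) = - \<omega> (k # xs @ j # i # ys)" for k
    by (rule alternating_swap[OF alternating_Cons[OF assms]])
  then show "kboundary h \<omega> (xs @ i # j # ys) = - kboundary h \<omega> (xs @ j # i # ys)"
    unfolding kboundary_def by (simp only: mult_minus_right sum_negf)
next
  fix xs i ys
  have "\<omega> (k # xs @ i # i # ys) = 0" for k by (rule alternating_repeat[OF alternating_Cons[OF assms]])
  then show "kboundary h \<omega> (xs @ i # i # ys) = 0" unfolding kboundary_def by simp
qed

lemma antisymmetric_sum:
  fixes a :: "'i \<Rightarrow> 'i \<Rightarrow> 'a::ab_group_add"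
  assumes "finite A" "\<And>i j. a i j = - a j i" "\<And>i. a i i = 0"
  shows "(\<Sum>i\<in>A. \<Sum>j\<in>A. a i j) = 0"
  using assms(1)
proof induction
  case (insert x A)
  have "(\<Sum>i\<in>A. a i x) = - (\<Sum>j\<in>A. a x j)"
    unfolding sum_negf[symmetric] by (intro sum.cong refl assms(2))
  with insert show ?case by (simp add: sum.distrib assms(3))
qed simp

lemma kboundary_kboundary:
  assumes "alternating \<omega>" shows "kboundary h (kboundary h \<omega>) is = 0"
proof -
  have "kboundary h (kboundary h \<omega>) is = (\<Sum>i\<in>UNIV. \<Sum>j\<in>UNIV. h i * h j * \<omega> (j # i # is))"
    by (simp add: kboundary_def sum_distrib_left mult.assoc)
  also have "\<dots> = 0"
  proof (rule antisymmetric_sum)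
    fix i j
    show "h i * h j * \<omega> (j # i # is) = - (h j * h i * \<omega> (i # j # is))"
      using alternating_swap[OF assms, of "[]" i j "is"] by (simp add: mult.commute)
    show "h i * h i * \<omega> (i # i # is) = 0"
      using alternating_repeat[OF assms, of "[]" i "is"] by simp
  qed simp
  finally show ?thesis .
qed

lemma wedge_zero: "wedge b (\<lambda>_. 0) is = 0"
  by (induction "is") auto

lemma wedge_uminus: "wedge b (\<lambda>js. - \<omega> js) is = - wedge b \<omega> is"
  by (induction "is" arbitrary: \<omega>) auto

lemma wedge_sum:
  "wedge b (\<lambda>js. \<Sum>k\<in>A. h k * \<omega> k js) is = (\<Sum>k\<in>A. h k * wedge b (\<omega> k) is)"
  by (induction "is" arbitrary: \<omega>)
    (simp_all add: sum_distrib_left sum_subtractf right_diff_distrib mult.left_commute)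

lemma alternating_wedge:
  assumes "alternating \<omega>" shows "alternating (wedge b \<omega>)"
proof (rule alternatingI)
  fix xs i j ys
  show "wedge b \<omega> (xs @ i # j # ys) = - wedge b \<omega> (xs @ j # i # ys)"
    using assms
  proof (induction xs arbitrary: \<omega>)
    case Nil
    have "(\<lambda>js. \<omega> (i # j # js)) = (\<lambda>js. - \<omega> (j # i # js))"
      by (rule ext) (rule alternating_swap[OF Nil, of "[]", unfolded append_Nil])
    then have "wedge b (\<lambda>js. \<omega> (i # j # js)) ys = - wedge b (\<lambda>js. \<omega> (j # i # js)) ys"
      by (simp only: wedge_uminus)
    then show ?case by simp
  next
    case (Cons k xs)
    have "\<omega> (xs @ i # j # ys) = - \<omega> (xs @ j # i # ys)" by (rule alternating_swap[OF Cons.prems])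
    with Cons.IH[OF alternating_Cons[OF Cons.prems]] show ?case by simp
  qed
next
  fix xs i ys
  show "wedge b \<omega> (xs @ i # i # ys) = 0"
    using assms
  proof (induction xs arbitrary: \<omega>)
    case Nil
    have "(\<lambda>js. \<omega> (i # i # js)) = (\<lambda>_. 0)"
      by (rule ext) (rule alternating_repeat[OF Nil, of "[]", unfolded append_Nil])
    then show ?case by (simp add: wedge_zero)
  next
    case (Cons k xs)
    have "\<omega> (xs @ i # i # ys) = 0" by (rule alternating_repeat[OF Cons.prems])
    with Cons.IH[OF alternating_Cons[OF Cons.prems]] show ?case by simp
  qed
qed

text \<open>Wedging with \<open>b\<close> is a homotopy between multiplication by \<open>\<Sum>b\<^sub>ih\<^sub>i\<close> and 0.\<close>

lemma kboundary_wedge: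
  "kboundary h (wedge b \<omega>) is = (\<Sum>i\<in>UNIV. b i * h i) * \<omega> is - wedge b (kboundary h \<omega>) is"
proof -
  have "kboundary h (wedge b \<omega>) is
      = (\<Sum>i\<in>UNIV. b i * h i * \<omega> is) - (\<Sum>i\<in>UNIV. h i * wedge b (\<lambda>js. \<omega> (i # js)) is)"
    by (simp add: kboundary_def right_diff_distrib sum_subtractf mult_ac)
  also have "(\<Sum>i\<in>UNIV. h i * wedge b (\<lambda>js. \<omega> (i # js)) is) = wedge b (kboundary h \<omega>) is"
    unfolding kboundary_def by (rule wedge_sum[symmetric])
  finally show ?thesis by (simp add: sum_distrib_right)
qed

lemma wedge_in_ideal:
  assumes "is_ideal I" "\<And>js. Suc (length js) = length is \<Longrightarrow> \<omega> js \<in> I"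
  shows "wedge b \<omega> is \<in> I"
  using assms(2)
proof (induction "is" arbitrary: \<omega>)
  case (Cons i "is")
  then show ?case by (auto intro!: ideal_diff[OF assms(1)] ideal_mult[OF assms(1)])
qed (simp add: ideal_zero[OF assms(1)])

subsection \<open>Ideals generated by powers of variables\<close>

definition power_ideal :: "nat \<Rightarrow> 'n set \<Rightarrow> ('n, 'k::comm_ring_1) mpoly set" where
  "power_ideal N S = {p. \<forall>m\<in>keys p. \<exists>i\<in>S. N \<le> lookup m i}"

lemma is_ideal_power_ideal: "is_ideal (power_ideal N S)"
proof (rule is_idealI)
  fix x y :: "('a, 'b) mpoly" assume "x \<in> power_ideal N S" "y \<in> power_ideal N S"
  then show "x + y \<in> power_ideal N S" using keys_add[of x y] by (auto simp: power_ideal_def)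
next
  fix c x :: "('a, 'b) mpoly" assume x: "x \<in> power_ideal N S"
  have "\<exists>i\<in>S. N \<le> lookup m i" if m: "m \<in> keys (c * x)" for m
  proof -
    obtain a b where "b \<in> keys x" "m = a + b" using m keys_mult[of c x] by blast
    moreover from this x obtain i where "i \<in> S" "N \<le> lookup b i" by (auto simp: power_ideal_def)
    ultimately show ?thesis by (intro bexI[of _ i]) (auto simp: lookup_add)
  qed
  then show "c * x \<in> power_ideal N S" by (simp add: power_ideal_def)
qed (simp add: power_ideal_def)

lemma power_ideal_mono: "S \<subseteq> T \<Longrightarrow> power_ideal N S \<subseteq> power_ideal N T"
  unfolding power_ideal_def by blast

lemma power_ideal_empty: "power_ideal N {} = {0}"
  by (auto simp: power_ideal_def)

lemma lookup_mvar_power_mult: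
  "lookup (mvar x ^ N * p) m = (if N \<le> lookup m x then lookup p (m - single x N) else 0)"
proof (cases "N \<le> lookup m x")
  case True
  then have "lookup (mvar x ^ N * p) (single x N + (m - single x N)) = lookup p (m - single x N)"
    by (simp add: mvar_power lookup_single_mult_add)
  then show ?thesis using True exponent_split[OF True] by simp
next
  case False
  then have "m \<noteq> single x N + m'" for m' by (auto simp: lookup_add)
  then show ?thesis using False by (simp add: mvar_power lookup_single_mult_0)
qed

lemma mvar_power_in_power_ideal: "mvar x ^ N \<in> power_ideal N (insert x S)"
  by (simp add: power_ideal_def mvar_power)

text \<open>The powers of the variables form a regular sequence, since multiplication by a power of \<open>x\<close> does
  not change the exponents of the other variables.\<close>

lemma power_ideal_cancel:
  assumes "mvar x ^ N * p \<in> power_ideal N S" "x \<notin> S"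
  shows "p \<in> power_ideal N S"
proof -
  have "\<exists>i\<in>S. N \<le> lookup m i" if m: "m \<in> keys p" for m
  proof -
    have "single x N + m \<in> keys (mvar x ^ N * p)"
      using m unfolding mvar_power keys_single_mult by blast
    then obtain i where "i \<in> S" "N \<le> lookup (single x N + m) i"
      using assms(1) by (auto simp: power_ideal_def)
    moreover from this assms(2) have "i \<noteq> x" by blast
    ultimately show ?thesis by (intro bexI[of _ i]) (simp_all add: lookup_add lookup_single)
  qed
  then show ?thesis by (simp add: power_ideal_def)
qed

text \<open>Quotients by a power of a variable, chosen additively (terms that are not divisible are
  dropped), so that they can be applied entrywise to an alternating function.\<close>

definition divide_power :: "'n \<Rightarrow> nat \<Rightarrow> ('n, 'k::comm_ring_1) mpoly \<Rightarrow> ('n, 'k) mpoly" where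
  "divide_power x N p = Poly_Mapping.map_key (\<lambda>m. single x N + m) p"

lemma lookup_divide_power: "lookup (divide_power x N p) m = lookup p (single x N + m)"
  unfolding divide_power_def by (subst map_key.rep_eq) (auto simp: inj_def)

lemma alternating_divide_power:
  assumes "alternating \<omega>" shows "alternating (\<lambda>is. divide_power x N (\<omega> is))"
proof (rule alternatingI)
  show "divide_power x N (\<omega> (xs @ i # j # ys)) = - divide_power x N (\<omega> (xs @ j # i # ys))" for xs i j ys
    using alternating_swap[OF assms, of xs i j ys]
    by (intro poly_mapping_eqI) (simp add: lookup_divide_power)
  show "divide_power x N (\<omega> (xs @ i # i # ys)) = 0" for xs i ys
    using alternating_repeat[OF assms, of xs i ys]
    by (intro poly_mapping_eqI) (simp add: lookup_divide_power)
qed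

lemma power_ideal_insert_remainder:
  assumes "p \<in> power_ideal N (insert x S)"
  shows "p - mvar x ^ N * divide_power x N p \<in> power_ideal N S"
proof -
  have "\<exists>i\<in>S. N \<le> lookup m i" if "m \<in> keys (p - mvar x ^ N * divide_power x N p)" for m
  proof -
    have "lookup p m - lookup (mvar x ^ N * divide_power x N p) m \<noteq> 0"
      using that by (simp add: in_keys_iff lookup_minus)
    then have "\<not> N \<le> lookup m x" "m \<in> keys p"
      using exponent_split[of N m x]
      by (auto simp: lookup_mvar_power_mult lookup_divide_power in_keys_iff split: if_splits)
    with assms show ?thesis by (auto simp: power_ideal_def)
  qed
  then show ?thesis by (simp add: power_ideal_def)
qed

subsection \<open>Depth sensitivity\<close>

text \<open>If the ideal of \<open>h\<close> contains the powers \<open>x\<^sub>i^N\<close> then the Koszul complex of \<open>h\<close> over the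
  quotient by the powers with \<open>i \<in> S\<close> is exact in degrees above the size of \<open>S\<close>. This is clear if \<open>S\<close>
  contains all variables. In the step from \<open>insert x S\<close> to \<open>S\<close>, \<open>a = x^N\<close>
  is a combination \<open>\<Sum>b\<^sub>ih\<^sub>i\<close>; a cycle \<open>\<omega>\<close> for \<open>S\<close> gives the cycle \<open>b \<wedge> \<omega>\<close> for \<open>insert x S\<close>,
  which is a boundary up to some \<open>a \<zeta>\<close>, hence \<open>a (\<omega> - \<partial> \<zeta>)\<close> vanishes modulo the powers
  for \<open>S\<close>, and \<open>a\<close> can be cancelled.\<close>

lemma koszul_exact:
  fixes h :: "'n::finite \<Rightarrow> ('n, 'k::comm_ring_1) mpoly"
  assumes h: "\<And>x. mvar x ^ N \<in> ideal_gen (range h)"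
    and "card S < p" "alternating \<omega>"
    and "\<And>is. Suc (length is) = p \<Longrightarrow> kboundary h \<omega> is \<in> power_ideal N S"
  shows "\<exists>\<eta>. alternating \<eta> \<and> (\<forall>is. length is = p \<longrightarrow> \<omega> is - kboundary h \<eta> is \<in> power_ideal N S)"
proof -
  have "\<exists>\<eta>. alternating \<eta> \<and> (\<forall>is. length is = p \<longrightarrow> \<omega> is - kboundary h \<eta> is \<in> power_ideal N (- T))"
    if "finite T" "card (- T) < p" "alternating \<omega>"
      "\<And>is. Suc (length is) = p \<Longrightarrow> kboundary h \<omega> is \<in> power_ideal N (- T)" for T p \<omega>
    using that
  proof (induction T arbitrary: p \<omega>)
    case empty
    have "\<omega> is = 0" if "length is = p" for "is"
    proof -
      have "card (set is) \<le> CARD('n)" by (rule card_mono) auto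
      then have "\<not> distinct is" using empty.prems(1) that by (auto dest: distinct_card)
      then show ?thesis by (rule alternating_eq_0[OF empty.prems(2)])
    qed
    then show ?case
      by (intro exI[of _ "\<lambda>_. 0"])
        (auto simp: alternating_def kboundary_def intro: ideal_zero[OF is_ideal_power_ideal])
  next
    case (insert x T)
    let ?S = "- insert x T"
    note I = is_ideal_power_ideal[of N ?S]
    have S: "- T = insert x ?S" using insert.hyps by auto
    then have card: "card (- T) < Suc p" using insert.prems(1) by (simp add: card_insert_if)
    obtain b where b: "mvar x ^ N = (\<Sum>i\<in>UNIV. b i * h i)" using h ideal_gen_rangeE by blast
    let ?a = "mvar x ^ N :: ('n, 'k) mpoly" and ?\<alpha> = "wedge b \<omega>"
    have wedge: "wedge b (kboundary h \<omega>) is \<in> power_ideal N ?S" if "length is = p" for "is"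
      using insert.prems(3) that by (intro wedge_in_ideal[OF I]) auto
    have "kboundary h ?\<alpha> is \<in> power_ideal N (- T)" if "Suc (length is) = Suc p" for "is"
      unfolding kboundary_wedge b[symmetric]
    proof (intro ideal_diff ideal_mult_right is_ideal_power_ideal)
      show "?a \<in> power_ideal N (- T)" unfolding S by (rule mvar_power_in_power_ideal)
      show "wedge b (kboundary h \<omega>) is \<in> power_ideal N (- T)"
        using wedge[of "is"] that power_ideal_mono[of ?S "- T" N] by auto
    qed
    from insert.IH[OF card alternating_wedge[OF insert.prems(2)] this] obtain \<eta> where
      \<eta>: "alternating \<eta>" "\<And>is. length is = Suc p \<Longrightarrow> ?\<alpha> is - kboundary h \<eta> is \<in> power_ideal N (- T)"
      by blast
    let ?\<beta> = "\<lambda>is. ?\<alpha> is - kboundary h \<eta> is"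
    define \<zeta> where "\<zeta> is = divide_power x N (?\<beta> is)" for "is"
    have "alternating ?\<beta>"
      by (intro alternating_diff alternating_wedge alternating_kboundary insert.prems(2) \<eta>(1))
    then have "alternating \<zeta>" unfolding \<zeta>_def by (rule alternating_divide_power)
    moreover have "\<omega> is - kboundary h \<zeta> is \<in> power_ideal N ?S" if p: "length is = p" for "is"
    proof (rule power_ideal_cancel)
      have "?\<beta> (i # is) - ?a * \<zeta> (i # is) \<in> power_ideal N ?S" for i
        unfolding \<zeta>_def using \<eta>(2)[of "i # is"] p S by (intro power_ideal_insert_remainder) simp
      then have "(\<Sum>i\<in>UNIV. h i * (?\<beta> (i # is) - ?a * \<zeta> (i # is))) \<in> power_ideal N ?S"
        by (intro ideal_sum[OF I] ideal_mult[OF I])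
      also have "(\<Sum>i\<in>UNIV. h i * (?\<beta> (i # is) - ?a * \<zeta> (i # is)))
          = kboundary h ?\<alpha> is - kboundary h (kboundary h \<eta>) is - ?a * kboundary h \<zeta> is"
        by (simp add: kboundary_def[of h _ "is"] right_diff_distrib sum_subtractf sum_distrib_left mult.left_commute)
      also have "\<dots> = ?a * (\<omega> is - kboundary h \<zeta> is) - wedge b (kboundary h \<omega>) is"
        unfolding kboundary_kboundary[OF \<eta>(1)] kboundary_wedge b[symmetric]
        by (simp add: right_diff_distrib)
      finally show "?a * (\<omega> is - kboundary h \<zeta> is) \<in> power_ideal N ?S"
        using ideal_add[OF I _ wedge[OF p], of "?a * (\<omega> is - kboundary h \<zeta> is) - wedge b (kboundary h \<omega>) is"]
        by (simp only: diff_add_cancel)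
    qed simp
    ultimately show ?case by (intro exI[of _ \<zeta>] conjI allI impI)
  qed
  from this[of "- S" p \<omega>] assms show ?thesis by simp
qed

text \<open>Exactness in degree one without any powers of variables: every syzygy is a boundary, and
  the entries of a boundary lie in the ideal.\<close>

lemma syzygy_in_ideal:
  fixes h P :: "'n::finite \<Rightarrow> ('n, 'k::comm_ring_1) mpoly"
  assumes h: "\<And>x. mvar x ^ N \<in> ideal_gen (range h)"
    and syz: "(\<Sum>i\<in>UNIV. P i * h i) = 0"
  shows "P i \<in> ideal_gen (range h)"
proof -
  define \<omega> where "\<omega> is = (case is of [i] \<Rightarrow> P i | _ \<Rightarrow> 0)" for "is"
  have "\<omega> is = 0" if "length is \<noteq> 1" for "is"
    using that by (auto simp: \<omega>_def split: list.split)
  then have "alternating \<omega>" by (intro alternatingI) simp_all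
  moreover have "kboundary h \<omega> [] = 0"
    using syz by (simp add: kboundary_def \<omega>_def mult.commute)
  ultimately obtain \<eta> where "\<omega> [i] - kboundary h \<eta> [i] \<in> power_ideal N {}"
    using koszul_exact[OF h, of "{}" 1 \<omega>] by (auto simp: power_ideal_empty)
  then have "P i = kboundary h \<eta> [i]" by (simp add: power_ideal_empty \<omega>_def)
  also have "\<dots> \<in> ideal_gen (range h)"
    unfolding kboundary_def by (intro ideal_sum is_ideal_gen ideal_mult_right ideal_gen_base) auto
  finally show ?thesis .
qed

text \<open>The entries of a syzygy lie in an ideal that is generated in degree \<open>c\<close>.\<close>

lemma syzygy_degree:
  fixes h P :: "'n::finite \<Rightarrow> ('n, 'k::comm_ring_1) mpoly"
  assumes N: "order_ge N \<subseteq> ideal_gen (range h)" and h: "\<And>i. homogeneous c (h i)"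
    and P: "\<And>i. homogeneous r (P i)" "\<exists>i. P i \<noteq> 0"
    and syz: "(\<Sum>i\<in>UNIV. P i * h i) = 0"
  shows "c \<le> r"
proof (rule ccontr)
  assume "\<not> c \<le> r"
  have "(mvar x :: ('n, 'k) mpoly) ^ N \<in> order_ge N" for x
    by (simp add: order_ge_def mvar_power)
  then have "P i \<in> ideal_gen (range h)" for i using syzygy_in_ideal[OF _ syz, of N] N by blast
  moreover have "ideal_gen (range h) \<subseteq> order_ge c"
    using h by (intro ideal_gen_least is_ideal_order_ge) (auto intro: homogeneous_order_ge)
  ultimately have "P i = 0" for i
    using order_ge_homogeneous_zero[OF P(1), of i c] \<open>\<not> c \<le> r\<close> by auto
  with P(2) show False by blast
qed

section \<open>Unique factorization\<close>

lemma polys_in_one [simp]: "1 \<in> polys_in V"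
  by (auto simp: polys_in_def)

lemma polys_in_UNIV [simp]: "polys_in UNIV = UNIV"
  by (auto simp: polys_in_def)

lemma polys_in_mono: "V \<subseteq> W \<Longrightarrow> polys_in V \<subseteq> polys_in W"
  unfolding polys_in_def by blast

lemma polys_in_add: "p \<in> polys_in V \<Longrightarrow> q \<in> polys_in V \<Longrightarrow> p + q \<in> polys_in V"
  using keys_add[of p q] unfolding polys_in_def by blast

lemma polys_in_uminus: "p \<in> polys_in V \<Longrightarrow> - p \<in> polys_in V"
  by (auto simp: polys_in_def in_keys_iff)

lemma polys_in_diff: "p \<in> polys_in V \<Longrightarrow> q \<in> polys_in V \<Longrightarrow> p - q \<in> polys_in V"
  using polys_in_add[of p V "- q"] polys_in_uminus[of q V] by simp

lemma polys_in_mult: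
  fixes p q :: "('n, 'k::comm_ring_1) mpoly"
  assumes "p \<in> polys_in V" "q \<in> polys_in V" shows "p * q \<in> polys_in V"
proof -
  have "keys m \<subseteq> V" if m: "m \<in> keys (p * q)" for m
  proof -
    obtain a b where "m = a + b" "a \<in> keys p" "b \<in> keys q" using m keys_mult[of p q] by blast
    then show ?thesis using assms keys_add[of a b] unfolding polys_in_def by blast
  qed
  then show ?thesis unfolding polys_in_def by blast
qed

lemma mvar_power_polys_in: "i \<in> V \<Longrightarrow> mvar i ^ k \<in> polys_in V"
  by (simp add: mvar_power polys_in_def)

lemma lookup_coeff_upoly:
  "lookup (coeff (upoly i p) k) m = (if lookup m i = 0 then lookup p (m + single i k) else 0)"
proof (induction p rule: mpoly_induct)
  case (add p m' c)
  have "lookup (coeff (upoly i (single m' c)) k) m = (if lookup m i = 0 then lookup (single m' c) (m + single i k) else 0)"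
  proof (cases "lookup m' i = k")
    case True
    have "m' - single i k = m \<longleftrightarrow> lookup m i = 0 \<and> m' = m + single i k"
    proof
      assume "m' - single i k = m"
      then show "lookup m i = 0 \<and> m' = m + single i k"
        using True exponent_split[of k m' i]
        by (auto simp: lookup_minus lookup_single lookup_add add.commute)
    qed (use True in \<open>auto simp: lookup_add\<close>)
    then show ?thesis using True by (auto simp: upoly_single lookup_single lookup_add "when_def")
  next
    case False
    then have "lookup m i = 0 \<Longrightarrow> m' \<noteq> m + single i k" by (auto simp: lookup_add)
    then show ?thesis using False by (auto simp: upoly_single lookup_single "when_def")
  qed
  with add show ?case by (auto simp: upoly_add lookup_add)
qed simp

lemma coeff_upoly_polys_in:
  assumes "p \<in> polys_in (insert i V)" shows "coeff (upoly i p) k \<in> polys_in V"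
proof -
  have "keys m \<subseteq> V" if m: "m \<in> keys (coeff (upoly i p) k)" for m
  proof -
    have "lookup (coeff (upoly i p) k) m \<noteq> 0" using m by (simp add: in_keys_iff)
    then have "lookup m i = 0" and "m + single i k \<in> keys p"
      by (auto simp: lookup_coeff_upoly in_keys_iff split: if_splits)
    then have sub: "keys (m + single i k) \<subseteq> insert i V" using assms by (auto simp: polys_in_def)
    show ?thesis
    proof
      fix j assume j: "j \<in> keys m"
      then have "j \<noteq> i" using \<open>lookup m i = 0\<close> by (auto simp: in_keys_iff)
      moreover have "j \<in> keys (m + single i k)" using j by (simp add: in_keys_iff lookup_add)
      ultimately show "j \<in> V" using sub by blast
    qed
  qed
  then show ?thesis by (auto simp: polys_in_def)
qed

definition vdeg :: "'n \<Rightarrow> ('n, 'k::comm_ring_1) mpoly \<Rightarrow> nat" where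
  "vdeg i p = degree (upoly i p)"

lemma vdeg_mult:
  fixes p q :: "('n::linorder, 'k::idom) mpoly"
  shows "p \<noteq> 0 \<Longrightarrow> q \<noteq> 0 \<Longrightarrow> vdeg i (p * q) = vdeg i p + vdeg i q"
  by (simp add: vdeg_def upoly_mult degree_mult_eq)

lemma vdeg_eq_0_iff: "vdeg i p = 0 \<longleftrightarrow> (\<forall>m\<in>keys p. i \<notin> keys m)"
proof
  assume deg: "vdeg i p = 0"
  show "\<forall>m\<in>keys p. i \<notin> keys m"
  proof
    fix m assume m: "m \<in> keys p"
    let ?k = "lookup m i"
    have "lookup (coeff (upoly i p) ?k) (m - single i ?k) = lookup p m"
      using exponent_split[of ?k m i]
      by (simp add: lookup_coeff_upoly lookup_minus lookup_single add.commute)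
    then have "coeff (upoly i p) ?k \<noteq> 0" using m by (auto simp: in_keys_iff)
    then have "?k \<le> vdeg i p" unfolding vdeg_def by (rule le_degree)
    then show "i \<notin> keys m" using deg by (simp add: in_keys_iff)
  qed
next
  assume "\<forall>m\<in>keys p. i \<notin> keys m"
  then have "p \<in> polys_in (- {i})" by (auto simp: polys_in_def)
  then show "vdeg i p = 0" unfolding vdeg_def by (subst upoly_polys_in) auto
qed

lemma polys_in_iff_vdeg: "p \<in> polys_in V \<longleftrightarrow> (\<forall>i. i \<notin> V \<longrightarrow> vdeg i p = 0)"
  unfolding polys_in_def vdeg_eq_0_iff by blast

lemma polys_in_factor:
  fixes p q :: "('n::linorder, 'k::idom) mpoly"
  assumes "p * q \<in> polys_in V" "p * q \<noteq> 0" shows "p \<in> polys_in V" "q \<in> polys_in V"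
  using assms by (auto simp: polys_in_iff_vdeg vdeg_mult)

text \<open>A measure for induction on factorizations: it is additive on products, and a nonzero polynomial
  of measure 0 is constant.\<close>

definition sdeg :: "('n::finite, 'k::comm_ring_1) mpoly \<Rightarrow> nat" where
  "sdeg p = (\<Sum>i\<in>UNIV. vdeg i p)"

lemma sdeg_mult:
  fixes p q :: "('n::{finite,linorder}, 'k::idom) mpoly"
  shows "p \<noteq> 0 \<Longrightarrow> q \<noteq> 0 \<Longrightarrow> sdeg (p * q) = sdeg p + sdeg q"
  by (simp add: sdeg_def vdeg_mult sum.distrib)

lemma const_unit:
  fixes p :: "('n, 'k::field) mpoly"
  assumes "p \<in> polys_in {}" "p \<noteq> 0" shows "p dvd 1"
proof -
  have "keys p \<subseteq> {0}" using assms(1) unfolding polys_in_def by auto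
  then have p: "p = single 0 (lookup p 0)" using mpoly_expand[of "{0}" p] by simp
  with assms(2) have "lookup p 0 \<noteq> 0" by auto
  then have "1 = p * single 0 (inverse (lookup p 0))" by (subst p) (simp add: mult_single)
  then show ?thesis by (rule dvdI)
qed

lemma unit_polys_in:
  fixes p :: "('n::linorder, 'k::field) mpoly"
  assumes "p dvd 1" shows "p \<in> polys_in V"
proof -
  obtain q where "1 = p * q" using assms by (rule dvdE)
  then show ?thesis using polys_in_factor(1)[of p q V] by simp
qed

lemma sdeg_pos:
  fixes p :: "('n::finite, 'k::field) mpoly"
  assumes "p \<noteq> 0" "\<not> p dvd 1" shows "0 < sdeg p"
proof (rule ccontr)
  assume "\<not> ?thesis"
  then have "p \<in> polys_in {}" by (simp add: sdeg_def polys_in_iff_vdeg)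
  with const_unit assms show False by blast
qed

lemma sdeg_cofactor_less:
  fixes p q :: "('n::{finite,linorder}, 'k::field) mpoly"
  assumes "p * q \<noteq> 0" "\<not> p dvd 1" shows "sdeg q < sdeg (p * q)"
  using assms sdeg_pos[of p] by (auto simp: sdeg_mult)

lemma irreducible_factor:
  fixes p :: "('n::{finite,linorder}, 'k::field) mpoly"
  assumes "p \<noteq> 0" "\<not> p dvd 1"
  shows "\<exists>q. irreducible q \<and> q dvd p"
  using assms
proof (induction "sdeg p" arbitrary: p rule: less_induct)
  case less
  show ?case
  proof (cases "irreducible p")
    case False
    then obtain a b where ab: "p = a * b" "\<not> a dvd 1" "\<not> b dvd 1"
      using less.prems unfolding irreducible_def by blast
    then have "sdeg b < sdeg p" using less.prems(1) sdeg_cofactor_less by blast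
    moreover have "b \<noteq> 0" using ab(1) less.prems(1) by auto
    ultimately obtain q where "irreducible q" "q dvd b" using less.hyps ab(3) by blast
    then show ?thesis using ab(1) by auto
  qed auto
qed

text \<open>Unique factorization is proved by induction on the set \<open>V\<close> of variables. Irreducibility in the full
  ring is the same as in the subring, because factors of elements of the subring belong to it;
  primality has to be relative to the subring during the induction. The second argument fixes the
  coefficient field, which the set \<open>V\<close> does not determine.\<close>

definition irreducibles_prime_in :: "'n set \<Rightarrow> ('n::{finite,linorder}, 'k::field) mpoly itself \<Rightarrow> bool" where
  "irreducibles_prime_in V _ \<longleftrightarrow>
    (\<forall>p::('n, 'k) mpoly. irreducible p \<longrightarrow> p \<in> polys_in V \<longrightarrow>
      (\<forall>u\<in>polys_in V. \<forall>s\<in>polys_in V. p dvd u * s \<longrightarrow> p dvd u \<or> p dvd s))"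

lemma is_ideal_multiples: "is_ideal {x. p dvd x}"
  by (rule is_idealI) auto

lemma dvd_iff_coeffs:
  fixes p u :: "('n, 'k::field) mpoly"
  assumes "p \<in> polys_in V" "i \<notin> V"
  shows "p dvd u \<longleftrightarrow> (\<forall>k. p dvd coeff (upoly i u) k)"
proof
  assume "p dvd u"
  then obtain w where "u = p * w" by (rule dvdE)
  then show "\<forall>k. p dvd coeff (upoly i u) k" by (simp add: upoly_mult upoly_polys_in[OF assms])
next
  assume "\<forall>k. p dvd coeff (upoly i u) k"
  then have "p dvd poly (upoly i u) (mvar i)"
    unfolding poly_altdef by (intro dvd_sum) auto
  then show "p dvd u" by (simp add: poly_upoly)
qed

context
  fixes V :: "'n::{finite,linorder} set" and i :: 'n and ty :: "('n, 'k::field) mpoly itself"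
  assumes i: "i \<notin> V" and irr: "irreducibles_prime_in V ty"
begin

abbreviation primitive :: "('n, 'k) mpoly \<Rightarrow> bool" where
  "primitive p \<equiv> \<forall>b\<in>polys_in V. b dvd p \<longrightarrow> b dvd 1"

text \<open>Gauss's lemma: primes of the coefficient ring remain prime after \<open>x\<^sub>i\<close> is adjoined.\<close>

lemma prime_coefficient:
  fixes p u s :: "('n, 'k) mpoly"
  assumes "irreducible p" "p \<in> polys_in V" "u \<in> polys_in (insert i V)" "s \<in> polys_in (insert i V)"
    and "p dvd u * s"
  shows "p dvd u \<or> p dvd s"
proof -
  have "(\<forall>k. coeff (upoly i u) k \<in> {x. p dvd x}) \<or> (\<forall>k. coeff (upoly i s) k \<in> {x. p dvd x})"
  proof (rule coeffs_prime[OF is_ideal_multiples])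
    show "a \<in> {x. p dvd x} \<or> b \<in> {x. p dvd x}"
      if "a \<in> polys_in V" "b \<in> polys_in V" "a * b \<in> {x. p dvd x}" for a b
      using irr assms(1,2) that unfolding irreducibles_prime_in_def by blast
    show "coeff (upoly i u * upoly i s) k \<in> {x. p dvd x}" for k
      using assms(5) dvd_iff_coeffs[OF assms(2) i, of "u * s"] by (simp add: upoly_mult)
  qed (intro coeff_upoly_polys_in assms)+
  then show ?thesis
    unfolding dvd_iff_coeffs[OF assms(2) i, of u] dvd_iff_coeffs[OF assms(2) i, of s] by simp
qed

text \<open>Remove from \<open>c\<close> one irreducible factor after the other: by Gauss's lemma such a factor divides \<open>p\<close>
  or the complementary divisor, and \<open>p\<close> is primitive.\<close>

lemma primitive_dvd_cancel:
  fixes c p z :: "('n, 'k) mpoly"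
  assumes "c \<in> polys_in V" "c \<noteq> 0" "p \<in> polys_in (insert i V)" "primitive p"
    and "z \<in> polys_in (insert i V)" "p dvd c * z"
  shows "p dvd z"
  using assms
proof (induction "sdeg c" arbitrary: c z rule: less_induct)
  case less
  show ?case
  proof (cases "c dvd 1 \<or> z = 0")
    case True
    then show ?thesis
    proof
      assume "c dvd 1"
      then obtain c' where "1 = c * c'" by (rule dvdE)
      then have "c * z * c' = z" by (metis mult.assoc mult.commute mult_1)
      moreover have "p dvd c * z * c'" using less.prems(6) by (rule dvd_mult2)
      ultimately show ?thesis by (simp only:)
    qed simp
  next
    case False
    then obtain q where q: "irreducible q" "q dvd c" using irreducible_factor less.prems(2) by blast
    then obtain c' where c': "c = q * c'" by (auto elim: dvdE)
    have qV: "q \<in> polys_in V" "c' \<in> polys_in V"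
      using polys_in_factor[of q c' V] less.prems(1,2) c' by auto
    have "\<not> q dvd 1" using q(1) by (auto simp: irreducible_def)
    obtain t where t: "c * z = p * t" using less.prems(6) by (rule dvdE)
    have "c * z \<in> polys_in (insert i V)"
      using less.prems(1,5) polys_in_mono[of V "insert i V"] by (intro polys_in_mult) auto
    moreover have "c * z \<noteq> 0" using less.prems(2) False by simp
    ultimately have "t \<in> polys_in (insert i V)" using polys_in_factor(2)[of p t] t by metis
    moreover have "q dvd p * t" using c' t by (metis dvd_triv_left mult.assoc)
    ultimately have "q dvd p \<or> q dvd t" using prime_coefficient[OF q(1) qV(1) less.prems(3)] by blast
    moreover have "\<not> q dvd p" using less.prems(4) qV(1) \<open>\<not> q dvd 1\<close> by blast
    ultimately obtain t' where "t = q * t'" by (auto elim: dvdE)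
    then have "q * (c' * z) = q * (p * t')" using t c' by (simp add: mult_ac)
    moreover have "q \<noteq> 0" using q(1) by (simp add: irreducible_def)
    ultimately have "p dvd c' * z" by simp
    moreover have "sdeg c' < sdeg c"
      using sdeg_cofactor_less[of q c'] less.prems(2) \<open>\<not> q dvd 1\<close> c' by simp
    moreover have "c' \<noteq> 0" using c' less.prems(2) by auto
    ultimately show ?thesis using less.hyps less.prems(3-5) qV(2) by blast
  qed
qed

lemma content_primitive:
  fixes w :: "('n, 'k) mpoly"
  assumes "w \<noteq> 0" "w \<in> polys_in (insert i V)"
  shows "\<exists>c w'. c \<in> polys_in V \<and> w' \<in> polys_in (insert i V) \<and> w = c * w' \<and> primitive w'"
  using assms
proof (induction "sdeg w" arbitrary: w rule: less_induct)
  case less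
  show ?case
  proof (cases "primitive w")
    case True
    then show ?thesis using less.prems by (intro exI[of _ 1] exI[of _ w]) auto
  next
    case False
    then obtain b where b: "b \<in> polys_in V" "b dvd w" "\<not> b dvd 1" by blast
    then obtain v where v: "w = b * v" by (auto elim: dvdE)
    have "v \<noteq> 0" "v \<in> polys_in (insert i V)"
      using polys_in_factor(2)[of b v] less.prems v by auto
    moreover have "sdeg v < sdeg w" using sdeg_cofactor_less[of b v] less.prems b(3) v by simp
    ultimately obtain c w' where "c \<in> polys_in V" "w' \<in> polys_in (insert i V)" "v = c * w'" "primitive w'"
      using less.hyps by blast
    then show ?thesis using v b(1)
      by (intro exI[of _ "b * c"] exI[of _ w']) (auto simp: mult.assoc intro: polys_in_mult)
  qed
qed

text \<open>Cancel leading terms with respect to \<open>x\<^sub>i\<close> after multiplication by the leading coefficient of \<open>w\<close>;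
  since \<open>w\<close> has least degree, the remainder vanishes. This replaces division with remainder over the
  field of fractions of the coefficient ring.\<close>

lemma pseudo_division:
  fixes M :: "('n, 'k) mpoly set"
  assumes M: "M \<subseteq> polys_in (insert i V)" "\<And>x y. x \<in> M \<Longrightarrow> y \<in> M \<Longrightarrow> x - y \<in> M"
      "\<And>c x. c \<in> polys_in (insert i V) \<Longrightarrow> x \<in> M \<Longrightarrow> c * x \<in> M"
    and w: "w \<in> M" "w \<noteq> 0" and min: "\<And>x. x \<in> M \<Longrightarrow> x \<noteq> 0 \<Longrightarrow> vdeg i w \<le> vdeg i x"
    and "z \<in> M"
  shows "\<exists>c\<in>polys_in V. c \<noteq> 0 \<and> w dvd c * z"
  using \<open>z \<in> M\<close>
proof (induction "vdeg i z" arbitrary: z rule: less_induct)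
  case less
  show ?case
  proof (cases "z = 0")
    case True
    then show ?thesis by (intro bexI[of _ 1]) auto
  next
    case False
    define n where "n = vdeg i z"
    define k where "k = n - vdeg i w"
    define lw where "lw = lead_coeff (upoly i w)"
    define lz where "lz = coeff (upoly i z) n"
    have k: "k \<le> n" "n - k = vdeg i w" using min[OF less.prems False] by (simp_all add: k_def n_def)
    have lw: "lw \<in> polys_in V" "lw \<noteq> 0"
      unfolding lw_def using w M(1) by (auto intro: coeff_upoly_polys_in)
    have lz: "lz \<in> polys_in V"
      unfolding lz_def using less.prems M(1) by (auto intro: coeff_upoly_polys_in)
    have sub: "polys_in V \<subseteq> (polys_in (insert i V) :: ('n, 'k) mpoly set)" by (rule polys_in_mono) auto
    define z' where "z' = lw * z - (lz * mvar i ^ k) * w"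
    have "z' \<in> M" unfolding z'_def
      by (intro M(2,3) less.prems w(1) polys_in_mult mvar_power_polys_in subsetD[OF sub] lw(1) lz) simp
    have "upoly i (mvar i ^ k) = monom (1 :: ('n, 'k) mpoly) k"
      by (simp add: mvar_power upoly_single)
    then have uz: "upoly i z' = smult lw (upoly i z) - smult lz (monom 1 k * upoly i w)"
      unfolding z'_def by (simp add: upoly_diff upoly_mult upoly_polys_in[OF lw(1) i] upoly_polys_in[OF lz i])
    have "coeff (upoly i z') n = 0"
      unfolding uz using k by (simp add: coeff_monom_mult lw_def lz_def vdeg_def)
    moreover have "degree (upoly i z') \<le> n"
    proof (rule degree_le, intro allI impI)
      fix m assume "n < m"
      then have "vdeg i w < m - k" "k \<le> m" using k by linarith+
      then show "coeff (upoly i z') m = 0"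
        unfolding uz using \<open>n < m\<close> by (simp add: coeff_monom_mult n_def vdeg_def coeff_eq_0)
    qed
    ultimately have "z' = 0 \<or> vdeg i z' < n"
      using eq_zero_or_degree_less[of "upoly i z'" n] by (auto simp: vdeg_def)
    then obtain c where c: "c \<in> polys_in V" "c \<noteq> 0" "w dvd c * z'"
    proof
      assume "z' = 0"
      then show thesis by (intro that[of 1]) auto
    next
      assume "vdeg i z' < n"
      then show thesis using less.hyps \<open>z' \<in> M\<close> that unfolding n_def by blast
    qed
    have "c * lw * z = c * z' + c * (lz * mvar i ^ k) * w" by (simp add: z'_def algebra_simps)
    then have "w dvd c * lw * z" using c(3) by simp
    then show ?thesis using c lw by (intro bexI[of _ "c * lw"]) (auto intro: polys_in_mult)
  qed
qed

text \<open>Let \<open>p\<close> divide \<open>u s\<close>. An element \<open>w\<close> of least degree in \<open>x\<^sub>i\<close> in the ideal generated by \<open>p\<close> and \<open>u\<close>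
  divides both up to factors from the coefficient ring, and so its primitive part \<open>w'\<close> divides \<open>p\<close>
  and \<open>u\<close>. Either \<open>w'\<close> is associated with \<open>p\<close>, and then \<open>p\<close> divides \<open>u\<close>; or \<open>w'\<close> is a unit, and then the
  ideal contains a nonzero \<open>c\<close> from the coefficient ring, \<open>p\<close> divides \<open>c s\<close>, and \<open>c\<close> can be cancelled.\<close>

lemma irreducibles_prime_in_insert: "irreducibles_prime_in (insert i V) ty"
  unfolding irreducibles_prime_in_def
proof (intro allI impI ballI)
  fix p u s :: "('n, 'k) mpoly"
  assume p: "irreducible p" "p \<in> polys_in (insert i V)"
    and u: "u \<in> polys_in (insert i V)" and s: "s \<in> polys_in (insert i V)" and us: "p dvd u * s"
  show "p dvd u \<or> p dvd s"
  proof (cases "p \<in> polys_in V")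
    case True
    then show ?thesis using prime_coefficient[OF p(1) _ u s us] by blast
  next
    case False
    have p0: "p \<noteq> 0" using p(1) by (simp add: irreducible_def)
    have prim: "primitive p"
    proof (intro ballI impI)
      fix b assume b: "b \<in> polys_in V" "b dvd p"
      then obtain t where t: "p = b * t" by (auto elim: dvdE)
      then have "b dvd 1 \<or> t dvd 1" using p(1) by (auto simp: irreducible_def)
      moreover have "\<not> t dvd 1"
      proof
        assume "t dvd 1"
        then have "t \<in> polys_in V" by (rule unit_polys_in)
        then show False using False t b(1) polys_in_mult by blast
      qed
      ultimately show "b dvd 1" by blast
    qed
    let ?M = "{z \<in> polys_in (insert i V). \<exists>\<alpha> \<beta>. z = \<alpha> * p + \<beta> * u}"
    have "p = 1 * p + 0 * u" "u = 0 * p + 1 * u" by simp_all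
    then have pM: "p \<in> ?M" and uM: "u \<in> ?M" using p(2) u by blast+
    then obtain w where w: "w \<in> ?M" "w \<noteq> 0" and min: "\<And>x. x \<in> ?M \<Longrightarrow> x \<noteq> 0 \<Longrightarrow> vdeg i w \<le> vdeg i x"
      using ex_has_least_nat[of "\<lambda>x. x \<in> ?M \<and> x \<noteq> 0" p "vdeg i"] p0 by blast
    have division: "\<exists>c\<in>polys_in V. c \<noteq> 0 \<and> w dvd c * z" if "z \<in> ?M" for z
    proof (rule pseudo_division[of ?M])
      show "x - y \<in> ?M" if "x \<in> ?M" "y \<in> ?M" for x y
      proof -
        obtain \<alpha> \<beta> \<alpha>' \<beta>' where "x = \<alpha> * p + \<beta> * u" "y = \<alpha>' * p + \<beta>' * u" using \<open>x \<in> ?M\<close> \<open>y \<in> ?M\<close> by blast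
        then have "x - y = (\<alpha> - \<alpha>') * p + (\<beta> - \<beta>') * u" by (simp add: algebra_simps)
        then show ?thesis using that polys_in_diff by blast
      qed
      show "c * x \<in> ?M" if "c \<in> polys_in (insert i V)" "x \<in> ?M" for c x
      proof -
        obtain \<alpha> \<beta> where "x = \<alpha> * p + \<beta> * u" using \<open>x \<in> ?M\<close> by blast
        then have "c * x = (c * \<alpha>) * p + (c * \<beta>) * u" by (simp add: algebra_simps)
        then show ?thesis using that polys_in_mult by blast
      qed
    qed (use w min that in auto)
    have "w \<in> polys_in (insert i V)" using w(1) by blast
    then obtain c w' where c: "c \<in> polys_in V" "w' \<in> polys_in (insert i V)" "w = c * w'" "primitive w'"
      using content_primitive w(2) by blast
    have dvd: "w' dvd z" if z: "z \<in> ?M" for z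
    proof -
      obtain c1 where c1: "c1 \<in> polys_in V" "c1 \<noteq> 0" "w dvd c1 * z" using division[OF z] by blast
      then have "w' dvd c1 * z" using c(3) dvd_mult_right by blast
      moreover have "z \<in> polys_in (insert i V)" using z by blast
      ultimately show ?thesis using primitive_dvd_cancel[OF c1(1,2) c(2,4)] by blast
    qed
    obtain q where q: "p = w' * q" using dvd[OF pM] by (auto elim: dvdE)
    then have "w' dvd 1 \<or> q dvd 1" using p(1) by (auto simp: irreducible_def)
    then show ?thesis
    proof
      assume "q dvd 1"
      then obtain q' where "1 = q * q'" by (rule dvdE)
      then have "w' = p * q'" using q by (simp add: mult.assoc)
      then have "p dvd w'" by simp
      then show ?thesis using dvd[OF uM] dvd_trans by blast
    next
      assume "w' dvd 1"
      then obtain v where v: "1 = w' * v" by (rule dvdE)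
      obtain \<alpha> \<beta> where "w = \<alpha> * p + \<beta> * u" using w(1) by blast
      moreover have "c = w * v" using c(3) v by (simp add: mult.assoc)
      ultimately have "c * s = (\<alpha> * v * s) * p + (\<beta> * v) * (u * s)" by (simp add: algebra_simps)
      then have "p dvd c * s" using us by simp
      moreover have "c \<noteq> 0" using c(3) w(2) by auto
      ultimately show ?thesis using primitive_dvd_cancel[OF c(1) _ p(2) prim s] by blast
    qed
  qed
qed

end

lemma irreducibles_prime_in_finite:
  "finite V \<Longrightarrow> irreducibles_prime_in V (ty :: ('n::{finite,linorder}, 'k::field) mpoly itself)"
proof (induction rule: finite_induct)
  case empty
  then show ?case using const_unit unfolding irreducibles_prime_in_def irreducible_def by blast
next
  case (insert i V)
  then show ?case by (intro irreducibles_prime_in_insert)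
qed

lemma irreducible_dvd_mult:
  fixes p u s :: "('n::{finite,linorder}, 'k::field) mpoly"
  assumes "irreducible p" "p dvd u * s" shows "p dvd u \<or> p dvd s"
  using irreducibles_prime_in_finite[of UNIV "TYPE(('n, 'k) mpoly)"] assms
  unfolding irreducibles_prime_in_def by simp

text \<open>Cancel the prime factors of \<open>g\<close> one by one against \<open>s\<close>, as none of them divides \<open>f\<close>.\<close>

lemma no_common_factor_dvd_cancel:
  fixes f g s :: "('n::{finite,linorder}, 'k::field) mpoly"
  assumes "no_common_factor f g" "g \<noteq> 0" "g dvd f * s"
  shows "g dvd s"
  using assms
proof (induction "sdeg g" arbitrary: g s rule: less_induct)
  case less
  show ?case
  proof (cases "g dvd 1")
    case True
    then show ?thesis by (rule dvd_trans) simp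
  next
    case False
    then obtain q where q: "irreducible q" "q dvd g" using irreducible_factor less.prems(2) by blast
    then have unit: "\<not> q dvd 1" and q0: "q \<noteq> 0" by (auto simp: irreducible_def)
    obtain g' where g': "g = q * g'" using q(2) by (rule dvdE)
    have "\<not> q dvd f" using less.prems(1) q(2) unit by (auto simp: no_common_factor_def)
    moreover have "q dvd f * s" using q(2) less.prems(3) by (rule dvd_trans)
    ultimately have "q dvd s" using irreducible_dvd_mult[OF q(1)] by blast
    then obtain s' where s': "s = q * s'" by (rule dvdE)
    have "q * g' dvd q * (f * s')" using less.prems(3) g' s' by (simp add: mult_ac)
    then have "g' dvd f * s'" using q0 by simp
    moreover have "sdeg g' < sdeg g" using sdeg_cofactor_less[of q g'] less.prems(2) unit g' by simp
    moreover have "no_common_factor f g'"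
      using less.prems(1) g' unfolding no_common_factor_def by (metis dvd_mult)
    moreover have "g' \<noteq> 0" using less.prems(2) g' by auto
    ultimately have "g' dvd s'" using less.hyps by blast
    then show ?thesis using g' s' by simp
  qed
qed

section \<open>Syzygies of the Jacobian ideal of a product\<close>

lemma homogeneous_uminus: "homogeneous d p \<Longrightarrow> homogeneous d (- p)"
  by (simp add: homogeneous_def in_keys_iff)

lemma homogeneous_diff: "homogeneous d p \<Longrightarrow> homogeneous d q \<Longrightarrow> homogeneous d (p - q)"
  using homogeneous_add[of d p "- q"] homogeneous_uminus[of d q] by simp

lemma homogeneous_sum: "(\<And>i. i \<in> A \<Longrightarrow> homogeneous d (f i)) \<Longrightarrow> homogeneous d (sum f A)"
  by (induction A rule: infinite_finite_induct) (auto intro: homogeneous_add)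

text \<open>A syzygy \<open>P\<close> of the partial derivatives of \<open>fg\<close> is a derivation killing \<open>fg\<close>. By coprimality
  it maps \<open>g\<close> to a multiple \<open>qg\<close>, and subtracting \<open>q/e\<close> times the Euler derivation kills \<open>g\<close>.\<close>

lemma jacobian_syz_of_factor:
  fixes f g :: "('n::{finite,linorder}, 'k::field) mpoly"
  assumes f: "f \<noteq> 0" "homogeneous d f" and g: "g \<noteq> 0" "homogeneous e g" and "1 \<le> e"
    and char: "\<not> CHAR('k) dvd e" "\<not> CHAR('k) dvd (d + e)" and coprime: "no_common_factor f g"
    and P: "P \<in> jacobian_syz (f * g)" "\<exists>i. P i \<noteq> 0" "\<And>i. homogeneous r (P i)"
  shows "\<exists>P'\<in>jacobian_syz g. (\<exists>i. P' i \<noteq> 0) \<and> (\<forall>i. homogeneous r (P' i))"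
proof -
  let ?D = "\<lambda>p. \<Sum>i\<in>UNIV. P i * pd i p"
  have "?D (f * g) = g * ?D f + f * ?D g"
    by (simp add: pd_mult distrib_left sum.distrib sum_distrib_left mult_ac)
  moreover have "?D (f * g) = 0" using P(1) by (simp add: jacobian_syz_def)
  ultimately have "f * ?D g = g * (- ?D f)" by (simp add: eq_neg_iff_add_eq_0 add.commute)
  then have "g dvd f * ?D g" by (rule dvdI)
  then have "g dvd ?D g" by (rule no_common_factor_dvd_cancel[OF coprime g(1)])
  then obtain q where q: "?D g = g * q" by (rule dvdE)
  \<comment> \<open>The component of \<open>q\<close> in the relevant degree. For \<open>r = 0\<close> there is none, as the derivation
    lowers degrees.\<close>
  define q' where "q' = (if 1 \<le> r then hcomp (r - 1) q else 0)"
  have "homogeneous (r + (e - 1)) (?D g)"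
    by (intro homogeneous_sum homogeneous_mult P(3) homogeneous_pd g(2))
  then have "?D g = hcomp (r + (e - 1)) (?D g)" by (simp add: hcomp_homogeneous)
  also have "\<dots> = hcomp (r + (e - 1)) (g * q)" unfolding q ..
  also have "\<dots> = g * q'"
    unfolding hpoly_mult hpoly_homogeneous[OF g(2)] coeff_monom_mult q'_def
    using \<open>1 \<le> e\<close> by (auto intro!: arg_cong[of _ _ "\<lambda>k. hcomp k q"])
  finally have q': "?D g = g * q'" .
  have hom_q': "homogeneous r (q' * mvar i)" for i
  proof (cases "1 \<le> r")
    case True
    then have "homogeneous (r - 1 + 1) (q' * mvar i)"
      unfolding q'_def by (intro homogeneous_mult homogeneous_mvar) simp
    then show ?thesis using True by simp
  qed (simp add: q'_def)
  define u :: "('n, 'k) mpoly" where "u = single 0 (inverse (of_nat e))"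
  have u: "u * of_nat e = 1" unfolding u_def by (rule mpoly_of_nat_inverse[OF char(1)])
  define P' where "P' i = P i - u * (q' * mvar i)" for i
  have sum_P': "(\<Sum>i\<in>UNIV. P' i * pd i p) = ?D p - u * q' * (\<Sum>i\<in>UNIV. mvar i * pd i p)" for p
    by (simp add: P'_def left_diff_distrib sum_subtractf sum_distrib_left mult.assoc)
  have "u * q' * (of_nat e * g) = (u * of_nat e) * (g * q')" by (simp only: mult_ac)
  also have "\<dots> = g * q'" unfolding u by simp
  finally have eq: "u * q' * (of_nat e * g) = g * q'" .
  have "(\<Sum>i\<in>UNIV. P' i * pd i g) = 0"
    unfolding sum_P' euler[OF g(2)] q' eq by (rule diff_self)
  then have "P' \<in> jacobian_syz g" by (simp add: jacobian_syz_def)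
  moreover have "homogeneous r (P' i)" for i
  proof -
    have "homogeneous (0 + r) (u * (q' * mvar i))"
      by (intro homogeneous_mult hom_q') (simp add: u_def homogeneous_def)
    then show ?thesis unfolding P'_def by (intro homogeneous_diff P(3)) simp
  qed
  \<comment> \<open>A nonzero multiple of the Euler derivation does not kill \<open>fg\<close>.\<close>
  moreover have "\<exists>i. P' i \<noteq> 0"
  proof (rule ccontr)
    assume "\<not> ?thesis"
    then have P'0: "P' i = 0" for i by blast
    have "u * q' * (of_nat (d + e) * (f * g)) = 0"
      using sum_P'[of "f * g"] P(1) unfolding euler[OF homogeneous_mult[OF f(2) g(2)]]
      by (simp add: P'0 jacobian_syz_def)
    moreover have "u \<noteq> 0" using u by auto
    moreover have "of_nat (d + e) \<noteq> (0 :: ('n, 'k) mpoly)"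
      using mpoly_of_nat_inverse[OF char(2), where 'n = 'n] by (metis mult_zero_right zero_neq_one)
    ultimately have "q' = 0" using f(1) g(1) by (simp del: of_nat_add)
    then have "P i = 0" for i using P'0[of i] by (simp add: P'_def)
    then show False using P(2) by blast
  qed
  ultimately show ?thesis by blast
qed

lemma indeg_jacobian_syz_mono:
  fixes f g :: "('n::{finite,linorder}, 'k::field) mpoly"
  assumes "f \<noteq> 0" "homogeneous d f" "g \<noteq> 0" "homogeneous e g" "1 \<le> e"
    and "\<not> CHAR('k) dvd e" "\<not> CHAR('k) dvd (d + e)" "no_common_factor f g"
  shows "indeg (jacobian_syz g) \<le> indeg (jacobian_syz (f * g))"
  unfolding indeg_def
proof (rule Inf_superset_mono, rule subsetI)
  fix x assume "x \<in> {enat r | r. \<exists>P\<in>jacobian_syz (f * g). (\<exists>i. P i \<noteq> 0) \<and> (\<forall>i. homogeneous r (P i))}"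
  then obtain r P where x: "x = enat r" and P: "P \<in> jacobian_syz (f * g)" "\<exists>i. P i \<noteq> 0" "\<And>i. homogeneous r (P i)"
    by blast
  show "x \<in> {enat r | r. \<exists>P\<in>jacobian_syz g. (\<exists>i. P i \<noteq> 0) \<and> (\<forall>i. homogeneous r (P i))}"
    using jacobian_syz_of_factor[OF assms P] x by blast
qed

lemma indeg_jacobian_syz_smooth:
  fixes g :: "('n::{finite,linorder}, 'k::field) mpoly"
  assumes "homogeneous e g" "\<not> CHAR('k) dvd e" "smooth_form g"
  shows "enat (e - 1) \<le> indeg (jacobian_syz g)"
proof -
  obtain N where N: "order_ge N \<subseteq> ideal_gen (range (\<lambda>i. pd i g))"
    using smooth_form_jacobian[OF assms] unfolding jacobian_ideal_def by blast
  have degree: "e - 1 \<le> r"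
    if "P \<in> jacobian_syz g" "\<exists>i. P i \<noteq> 0" "\<forall>i. homogeneous r (P i)" for r P
    using that by (intro syzygy_degree[OF N homogeneous_pd[OF assms(1)], of r P]) (auto simp: jacobian_syz_def)
  show ?thesis
    unfolding indeg_def
  proof (rule Inf_greatest)
    fix x assume "x \<in> {enat r | r. \<exists>P\<in>jacobian_syz g. (\<exists>i. P i \<noteq> 0) \<and> (\<forall>i. homogeneous r (P i))}"
    then obtain r where "x = enat r" "e - 1 \<le> r" using degree by blast
    then show "enat (e - 1) \<le> x" by simp
  qed
qed

section \<open>Depth zero\<close>

text \<open>The element \<open>y\<close> is killed modulo \<open>I\<close> by a power of each \<open>a \<in> A\<close>, so no such \<open>a\<close> is a nonzerodivisor.\<close>

lemma depth_quotient_eq_0: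
  assumes I: "is_ideal I" and y: "y \<notin> I" and ann: "\<And>a. a \<in> A \<Longrightarrow> \<exists>k. a ^ k * y \<in> I"
  shows "depth_quotient A I = 0"
proof -
  have "as = []" if as: "set as \<subseteq> A" "regular_sequence_on_quotient I as" for as
  proof (cases as)
    case (Cons a as')
    then have cancel: "x \<in> I" if "a * x \<in> I" for x
      using as(2) that ideal_gen_eq[OF I] unfolding regular_sequence_on_quotient_def by fastforce
    obtain k where "a ^ k * y \<in> I" using ann as(1) Cons by auto
    then have "y \<in> I"
      by (induction k) (auto simp: mult.assoc intro: cancel)
    with y show ?thesis by blast
  qed
  then have "depth_quotient A I \<le> 0"
    unfolding depth_quotient_def by (intro Sup_least) (auto simp: zero_enat_def)
  then show ?thesis by simp
qed

text \<open>If all minors of size two are in \<open>P\<close>, the rows are dependent with coefficients \<open>- g\<^sub>i\<close> and \<open>f\<^sub>i\<close>, for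
  each \<open>i\<close>. By independence all \<open>f\<^sub>i\<close> are in \<open>P\<close>, and then the first row is dependent by itself.\<close>

lemma rank_mod_two_minor:
  fixes f g :: "('n::finite, 'k::field) mpoly"
  assumes P: "prime_ideal P" and rank: "rank_mod P (jacobian_matrix [f, g]) = 2"
  shows "\<exists>i j. pd i f * pd j g - pd j f * pd i g \<notin> P"
proof (rule ccontr)
  assume "\<not> ?thesis"
  then have minor: "pd i f * pd j g - pd j f * pd i g \<in> P" for i j by blast
  let ?rows = "jacobian_matrix [f, g]"
  let ?A = "{card S | S. S \<subseteq> {..<length ?rows} \<and> rows_independent_mod P ?rows S}"
  have "?A \<subseteq> card ` Pow {..<length ?rows}" by blast
  then have "finite ?A" by (rule finite_subset) simp
  moreover have "0 \<in> ?A" by (auto simp: rows_independent_mod_def intro!: exI[of _ "{}"])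
  ultimately have "Max ?A \<in> ?A" by (intro Max_in) auto
  then obtain S where S: "card S = 2" "S \<subseteq> {..<2}" "rows_independent_mod P ?rows S"
    using rank unfolding rank_mod_def by (auto simp: jacobian_matrix_def numeral_2_eq_2)
  then have "S = {0, 1}" using card_subset_eq[of "{..<2}" S] by (auto simp: numeral_2_eq_2 lessThan_Suc)
  with S(3) have indep: "c 0 \<in> P \<and> c 1 \<in> P" if "\<And>j. c 0 * pd j f + c 1 * pd j g \<in> P"
    for c :: "nat \<Rightarrow> ('n, 'k) mpoly"
    using that unfolding rows_independent_mod_def by (simp add: jacobian_matrix_def)
  have "pd i f \<in> P" for i
  proof -
    have "- pd i g * pd j f + pd i f * pd j g \<in> P" for j using minor[of i j] by (simp add: algebra_simps)
    then show ?thesis using indep[of "\<lambda>k. if k = 0 then - pd i g else pd i f"] by simp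
  qed
  then have "1 \<in> P" using indep[of "\<lambda>k. if k = 0 then 1 else 0"] by simp
  then show False using prime_ideal_one[OF P] by blast
qed

text \<open>The ideal \<open>J\<^bsub>fg\<^esub> : g\<close> contains \<open>f\<close>, all \<open>f\<^sub>i g\<close> and all minors of the Jacobian matrix. A homogeneous
  prime above it other than the irrelevant one contains \<open>f\<close>, hence \<open>g\<close> by smoothness of \<open>f\<close>; enlarging
  it to the prime of a closed point yields a prime of height \<open>n - 1\<close> above \<open>f\<close>, \<open>g\<close> and
  all minors, against the rank condition.\<close>

lemma colon_jacobian_irrelevant:
  fixes f g :: "('n::{finite,linorder}, 'k::field) mpoly"
  assumes f: "homogeneous d f" and g: "homogeneous e g"
    and char: "\<not> CHAR('k) dvd (d + e)" and smooth: "smooth_form f"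
    and rank: "\<And>P. prime_ideal P \<Longrightarrow> ideal_gen {f, g} \<subseteq> P \<Longrightarrow> height P = enat (CARD('n) - 1)
      \<Longrightarrow> rank_mod P (jacobian_matrix [f, g]) = 2"
  shows "\<exists>N. \<forall>a\<in>order_ge N. a * g \<in> jacobian_ideal (f * g)"
proof -
  let ?J = "jacobian_ideal (f * g)"
  let ?C = "{a. a * g \<in> ?J}"
  have fg: "homogeneous (d + e) (f * g)" by (rule homogeneous_mult[OF f g])
  have "is_ideal ?C"
    by (rule is_idealI) (auto simp: ideal_zero distrib_right mult.assoc intro: ideal_add ideal_mult)
  moreover have "hcomp k a * g \<in> ?J" if "a * g \<in> ?J" for a k
  proof -
    have "hcomp (e + k) (g * a) = g * hcomp k a"
      unfolding hpoly_mult hpoly_homogeneous[OF g] coeff_monom_mult by simp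
    then show ?thesis
      using graded_idealD[OF graded_jacobian[OF fg] that, of "e + k"] by (simp add: mult.commute)
  qed
  ultimately have graded: "graded_ideal ?C" by (simp add: graded_ideal_def)
  have "\<exists>N. order_ge N \<subseteq> ?C"
  proof (rule order_ge_subset_if_no_graded_primes[OF graded])
    fix P assume P: "prime_ideal P" "graded_ideal P" "?C \<subseteq> P"
    show "max_ideal \<subseteq> P"
    proof (rule ccontr)
      assume irr: "\<not> max_ideal \<subseteq> P"
      have "f \<in> ?C"
        using form_in_ideal_if_pd_in_ideal[OF fg char is_ideal_jacobian pd_in_jacobian] by simp
      then have "f \<in> P" using P(3) by blast
      then obtain i where "pd i f \<notin> P"
        using smooth P(1,2) irr graded_ideal_homogeneous unfolding smooth_form_def by blast
      moreover have "pd i f * g \<in> ?C"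
        using square_mult_pd_in_jacobian[OF f g char, of i] by (simp add: power2_eq_square mult_ac)
      then have "pd i f * g \<in> P" using P(3) by blast
      ultimately have "g \<in> P" using prime_idealD[OF P(1)] by blast
      obtain Q v N where Q: "prime_ideal Q" "graded_ideal Q" "P \<subseteq> Q" "mvar v \<notin> Q"
        "order_ge (Suc N) \<subseteq> ideal_gen (insert (mvar v) Q)"
        by (rule graded_prime_of_point[OF P(1,2) irr])
      have "ideal_gen {f, g} \<subseteq> Q"
        using \<open>f \<in> P\<close> \<open>g \<in> P\<close> Q(3) by (intro ideal_gen_least prime_ideal_ideal[OF Q(1)]) auto
      then have "rank_mod Q (jacobian_matrix [f, g]) = 2"
        using rank Q(1) height_of_point[OF Q(1,2,4,5)] by blast
      then obtain j k where jk: "pd j f * pd k g - pd k f * pd j g \<notin> Q"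
        using rank_mod_two_minor[OF Q(1)] by blast
      \<comment> \<open>Cramer's rule for the equations expressing the derivatives of the product by \<open>f\<close> and \<open>g\<close>.\<close>
      have "(pd j f * pd k g - pd k f * pd j g) * g = pd k g * pd j (f * g) - pd j g * pd k (f * g)"
        by (simp add: pd_mult algebra_simps)
      also have "\<dots> \<in> ?J"
        by (intro ideal_diff is_ideal_jacobian ideal_mult pd_in_jacobian)
      finally show False using jk P(3) Q(3) by blast
    qed
  qed
  then show ?thesis by blast
qed

text \<open>The form \<open>g\<close> lies in the saturation of the Jacobian ideal, but not in the ideal itself,
  which is generated in degree \<open>d + e - 1 > e\<close>.\<close>

lemma depth_jacobian_eq_0:
  fixes f g :: "('n::{finite,linorder}, 'k::field) mpoly"
  assumes f: "homogeneous d f" and g: "g \<noteq> 0" "homogeneous e g" and "2 \<le> d"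
    and char: "\<not> CHAR('k) dvd (d + e)" and smooth: "smooth_form f"
    and rank: "\<And>P. prime_ideal P \<Longrightarrow> ideal_gen {f, g} \<subseteq> P \<Longrightarrow> height P = enat (CARD('n) - 1)
      \<Longrightarrow> rank_mod P (jacobian_matrix [f, g]) = 2"
  shows "depth_quotient max_ideal (jacobian_ideal (f * g)) = 0"
proof (rule depth_quotient_eq_0)
  have "jacobian_ideal (f * g) \<subseteq> order_ge (d + e - 1)"
    using homogeneous_pd[OF homogeneous_mult[OF f g(2)]]
    by (intro jacobian_ideal_subset is_ideal_order_ge homogeneous_order_ge) auto
  moreover have "e < d + e - 1" using \<open>2 \<le> d\<close> by linarith
  then have "g \<notin> order_ge (d + e - 1)" using order_ge_homogeneous_zero[OF g(2)] g(1) by blast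
  ultimately show "g \<notin> jacobian_ideal (f * g)" by blast
  obtain N where N: "\<And>a. a \<in> order_ge N \<Longrightarrow> a * g \<in> jacobian_ideal (f * g)"
    using colon_jacobian_irrelevant[OF f g(2) char smooth rank] by blast
  fix a :: "('n, 'k) mpoly" assume "a \<in> max_ideal"
  then have "prod_list (replicate N a) \<in> order_ge (length (replicate N a))"
    using max_ideal_order_ge by (intro prod_list_order_ge) auto
  then have "a ^ N \<in> order_ge N" by simp
  then show "\<exists>k. a ^ k * g \<in> jacobian_ideal (f * g)" using N by blast
qed simp

theorem proposition3p2:
  fixes f g F :: "('n::{finite,linorder}, 'k::field) mpoly"
    and d e :: nat
  assumes "infinite (UNIV :: 'k set)"
    and "CARD('n) \<ge> 3"
    and "f \<noteq> 0" and "homogeneous d f"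
    and "g \<noteq> 0" and "homogeneous e g"
    and "2 \<le> d" and "d \<le> e"
    and "F = f * g"
  shows
    "(\<not> CHAR('k) dvd d \<and> \<not> CHAR('k) dvd (d + e) \<and> smooth_form f
        \<longrightarrow> g ^ 2 \<in> saturation max_ideal (jacobian_ideal F))
     \<and>
     (\<not> CHAR('k) dvd e \<and> \<not> CHAR('k) dvd (d + e) \<and> no_common_factor f g
        \<longrightarrow> indeg (jacobian_syz F) \<ge> indeg (jacobian_syz g)
          \<and> (smooth_form g
               \<longrightarrow> indeg (jacobian_syz F) \<ge> enat (e - 1) \<and> e - 1 \<ge> (d + e) div 2 - 1))
     \<and>
     (\<not> CHAR('k) dvd d \<and> \<not> CHAR('k) dvd e \<and> \<not> CHAR('k) dvd (d + e)
        \<and> smooth_form f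
        \<and> (\<forall>P. prime_ideal P \<and> ideal_gen {f, g} \<subseteq> P \<and> height P = enat (CARD('n) - 1)
               \<longrightarrow> rank_mod P (jacobian_matrix [f, g]) = 2)
        \<and> is_primary_to max_ideal (ideal_gen (insert f (jacobian_ideal g)))
        \<longrightarrow> depth_quotient max_ideal (jacobian_ideal F) = 0)"
proof (intro conjI impI; (elim conjE)?)
  assume "\<not> CHAR('k) dvd d" "\<not> CHAR('k) dvd (d + e)" "smooth_form f"
  then show "g ^ 2 \<in> saturation max_ideal (jacobian_ideal F)"
    unfolding \<open>F = f * g\<close> by (rule square_in_saturation_jacobian[OF assms(4,6)])
next
  assume *: "\<not> CHAR('k) dvd e" "\<not> CHAR('k) dvd (d + e)" "no_common_factor f g"
  have "1 \<le> e" using assms(7,8) by simp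
  from indeg_jacobian_syz_mono[OF assms(3-6) this *]
  show mono: "indeg (jacobian_syz g) \<le> indeg (jacobian_syz F)" unfolding \<open>F = f * g\<close> .
  assume "smooth_form g"
  from indeg_jacobian_syz_smooth[OF assms(6) *(1) this] mono
  show "enat (e - 1) \<le> indeg (jacobian_syz F)" by (rule order_trans)
  show "(d + e) div 2 - 1 \<le> e - 1" using assms(8) by simp
next
  assume "\<not> CHAR('k) dvd (d + e)" "smooth_form f"
    and "\<forall>P. prime_ideal P \<and> ideal_gen {f, g} \<subseteq> P \<and> height P = enat (CARD('n) - 1)
      \<longrightarrow> rank_mod P (jacobian_matrix [f, g]) = 2"
  then show "depth_quotient max_ideal (jacobian_ideal F) = 0"
    unfolding \<open>F = f * g\<close> by (intro depth_jacobian_eq_0[OF assms(4-7)]) auto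
qed

end
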